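(* For positive integers $h$, $w$, and $n$, \begin{align*} |\mathrm{CSYT}_n(2h+1,2w+1)|&=|\mathrm{VT}_n(h,w)|,\\ |\mathrm{CSYT}_n(2h+1,2w)|&=|\mathrm{VT}_n(h,w^* )|,\\ |\mathrm{CSYT}_n(2h,2w+1)|&=|\mathrm{VT}_n(h^*,w)|,\\ |\mathrm{CSYT}_n(2h,2w)|&=\sum_{T\in\mathrm{VT}'_n(h,w)}(-1)^{z(T)}. \end{align*}
   Context: Tableaux: a standard Young tableau of size $n$ is a filling of the Young diagram of a partition of $n$ with $1,2,\dots,n$ (each once), increasing along rows and down columns. $\mathrm{Par}(a,b)$ is the set of partitions $\lambda$ with at most $a$ positive parts and $\lambda_1-\lambda_a\le b$ (with $\lambda_i=0$ beyond the length). For positive integers $a,b$, a semistandard (in particular, standard) Young tableau $T$ is $(a,b)$-cylindric if it has at most $a$ rows and $T\cup(T+(a,-b))$ is a semistandard Young tableau of a valid skew shape, where $T+(a,-b)$ is $T$ shifted $a$ units down and $b$ units to the left (this forces the shape of $T$ to lie in $\mathrm{Par}(a,b)$). $\mathrm{CSYT}_n(a,b)$ is the set of $(a,b)$-cylindric standard Young tableaux of size $n$. Vacillating tableaux: $\mathrm{VT}_n(h,w)$ is the set of sequences $(\lambda^0,\lambda^1,\dots,\lambda^n)$ of partitions with $\lambda^0=\lambda^n=\emptyset$, such that the Young diagrams of $\lambda^{i-1}$ and $\lambda^i$ differ by at most one cell for $i=1,\dots,n$, and each $\lambda^i$ has at most $h$ rows and at most $w$ columns. Such a sequence is identified with a walk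 of length $n$ from $\mathbf 0$ to $\mathbf 0$ with steps in $\{\pm\varepsilon_i:1\le i\le h\}\cup\{\mathbf 0\}$ ($\varepsilon_i$ the $i$-th standard basis vector) staying in $\{(x_1,\dots,x_h)\in\mathbb Z^h:w\ge x_1\ge\dots\ge x_h\ge0\}$; a zero step is a step $\mathbf 0$, i.e. $\lambda^{i-1}=\lambda^i$, and it occurs on a hyperplane if the point $\lambda^i$ lies on it. $\mathrm{VT}_n(h,w^* )$ is the set of walks in $\mathrm{VT}_n(h,w)$ in which no zero step occurs on the hyperplane $x_1=w$. $\mathrm{VT}_n(h^*,w)$ is the set of walks in $\mathrm{VT}_n(h,w)$ in which zero steps occur only on the hyperplane $x_h=0$. $\mathrm{VT}'_n(h,w)$ is the set of walks in $\mathrm{VT}_n(h,w)$ in which every zero step occurs on the hyperplane $x_h=0$ or on the hyperplane $x_1=w$ but not on both. For $p\in\mathrm{VT}'_n(h,w)$, $z(p)$ is the number of zero steps of $p$ on the hyperplane $x_1=w$. *)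

theory Defs
  imports Main
begin

text \<open>
  Parts, rows and columns are numbered from 0, so the first part of a partition \<open>l\<close> is \<open>l 0\<close>
  and its \<open>h\<close>-th part is \<open>l (h - 1)\<close>.
\<close>

definition is_partition :: "(nat \<Rightarrow> nat) \<Rightarrow> bool" where
  "is_partition l \<longleftrightarrow> antimono l \<and> finite {i. l i \<noteq> 0}"

text \<open>
  Cells are pairs (row, column), with rows numbered downwards.  They are integer pairs because
  shifting a tableau to the left produces negative columns.
\<close>

type_synonym cell = "int \<times> int"

definition diagram :: "(nat \<Rightarrow> nat) \<Rightarrow> cell set" where
  "diagram l = {(int i, int j) | i j. j < l i}"

text \<open>Skew diagrams are taken up to translation in the plane.\<close>

definition is_skew_shape :: "cell set \<Rightarrow> bool" where
  "is_skew_shape S \<longleftrightarrow>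
     (\<exists>l m r c. is_partition l \<and> is_partition m \<and> diagram m \<subseteq> diagram l \<and>
        S = (\<lambda>(i, j). (i + r, j + c)) ` (diagram l - diagram m))"

text \<open>A filling is a partial map whose domain is the set of filled cells.\<close>

type_synonym filling = "cell \<rightharpoonup> nat"

definition is_skew_ssyt :: "filling \<Rightarrow> bool" where
  "is_skew_ssyt T \<longleftrightarrow>
     is_skew_shape (dom T) \<and> 0 \<notin> ran T \<and>
     (\<forall>i j j' x y. T (i, j) = Some x \<and> T (i, j') = Some y \<and> j < j' \<longrightarrow> x \<le> y) \<and>
     (\<forall>i i' j x y. T (i, j) = Some x \<and> T (i', j) = Some y \<and> i < i' \<longrightarrow> x < y)"

text \<open>The bijection with \<open>{1..n}\<close> forces the shape to be a partition of \<open>n\<close>.\<close>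

definition SYT :: "nat \<Rightarrow> filling set" where
  "SYT n = {T. (\<exists>l. is_partition l \<and> dom T = diagram l) \<and>
     bij_betw (\<lambda>c. the (T c)) (dom T) {1..n} \<and>
     (\<forall>i j j' x y. T (i, j) = Some x \<and> T (i, j') = Some y \<and> j < j' \<longrightarrow> x < y) \<and>
     (\<forall>i i' j x y. T (i, j) = Some x \<and> T (i', j) = Some y \<and> i < i' \<longrightarrow> x < y)}"

definition shift :: "nat \<Rightarrow> nat \<Rightarrow> filling \<Rightarrow> filling" where
  "shift a b T = (\<lambda>(i, j). T (i - int a, j + int b))"

text \<open>
  The row bound makes the domains of \<open>T\<close> and \<open>shift a b T\<close> disjoint when \<open>T\<close> has partition
  shape, so \<open>++\<close> is then their union.
\<close>

definition cylindric :: "nat \<Rightarrow> nat \<Rightarrow> filling \<Rightarrow> bool" where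
  "cylindric a b T \<longleftrightarrow> (\<forall>(i, j) \<in> dom T. i < int a) \<and> is_skew_ssyt (T ++ shift a b T)"

definition CSYT :: "nat \<Rightarrow> nat \<Rightarrow> nat \<Rightarrow> filling set" where
  "CSYT n a b = {T \<in> SYT n. cylindric a b T}"

definition VT :: "nat \<Rightarrow> nat \<Rightarrow> nat \<Rightarrow> (nat \<Rightarrow> nat) list set" where
  "VT n h w = {p. length p = Suc n \<and> p ! 0 = (\<lambda>_. 0) \<and> p ! n = (\<lambda>_. 0) \<and>
     (\<forall>l \<in> set p. is_partition l \<and> (\<forall>i\<ge>h. l i = 0) \<and> (\<forall>i. l i \<le> w)) \<and>
     (\<forall>i<n. card (sym_diff (diagram (p ! i)) (diagram (p ! Suc i))) \<le> 1)}"

text \<open>The positions of the zero steps, each identified by the index of its starting point.\<close>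

definition zero_steps :: "(nat \<Rightarrow> nat) list \<Rightarrow> nat set" where
  "zero_steps p = {i. Suc i < length p \<and> p ! i = p ! Suc i}"

definition VT_wstar :: "nat \<Rightarrow> nat \<Rightarrow> nat \<Rightarrow> (nat \<Rightarrow> nat) list set" where
  "VT_wstar n h w = {p \<in> VT n h w. \<forall>i \<in> zero_steps p. (p ! i) 0 \<noteq> w}"

definition VT_hstar :: "nat \<Rightarrow> nat \<Rightarrow> nat \<Rightarrow> (nat \<Rightarrow> nat) list set" where
  "VT_hstar n h w = {p \<in> VT n h w. \<forall>i \<in> zero_steps p. (p ! i) (h - 1) = 0}"

text \<open>The inequality between truth values is exclusive or.\<close>

definition VT_prime :: "nat \<Rightarrow> nat \<Rightarrow> nat \<Rightarrow> (nat \<Rightarrow> nat) list set" where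
  "VT_prime n h w =
     {p \<in> VT n h w. \<forall>i \<in> zero_steps p. ((p ! i) (h - 1) = 0) \<noteq> ((p ! i) 0 = w)}"

definition num_zero_w :: "nat \<Rightarrow> (nat \<Rightarrow> nat) list \<Rightarrow> nat" where
  "num_zero_w w p = card {i \<in> zero_steps p. (p ! i) 0 = w}"

end

theory Submission
  imports Defs "Jordan_Normal_Form.Determinant" Complex_Main "HOL-Library.FuncSet"
begin

text \<open>
  Both sides of the identities count walks of non-colliding particles.  Reading a cylindric tableau of
  shape \<open>l\<close> as the sequence in which its entries are added, and putting particle \<open>i\<close> at
  \<open>i - l i\<close>, one obtains \<open>a\<close> particles on a circle with \<open>N = a + b\<close> sites: each entry moves
  one particle one step in a fixed direction, and the seam condition says exactly that the last
  particle never collides with the first one around the circle.  A vacillating tableau is a walk of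
  \<open>h\<close> particles on a line of \<open>h + w\<close> sites, in which particles move in both directions.
  The circle count starts at the packed configuration and is free at the end; the line count starts
  and ends at the packed configuration.

  All four cases are treated at once by writing \<open>a = 2 h + c\<close> and \<open>b = 2 w + 1 - \<gamma>\<close> with
  \<open>c, \<gamma> \<in> {0, 1}\<close> (below, \<open>\<gamma>\<close> is called \<open>gm\<close>).  Giving a zero step at \<open>x\<close> the weight
  \<open>c + (1 - c) [x\<^sub>h = 0] - \<gamma> [x\<^sub>1 = w]\<close> turns the right-hand sides into the weighted
  count of all walks in \<open>VT n h w\<close> (\<open>sum_indicator_weight\<close>, \<open>sum_signed_weight\<close>).

  Let \<open>z\<close> run over the \<open>h\<close>-tuples of solutions of \<open>z ^ N = \<plusminus>1\<close>, with sign \<open>+\<close> exactly when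
  \<open>a\<close> is odd.  Both counts are expanded in determinants of powers of such numbers.

  \<^item> For walks on the line, the functions \<open>phi x z\<close>, symmetric or antisymmetric under reflection at either end,
  give determinants that vanish at collisions and satisfy the boundary conditions which produce the
  weights of the zero steps.  Orthogonality over the roots and Andreief's identity supply the
  initial value (\<open>box_sum_init\<close>), so the weighted count is \<open>box_sum\<close>
  (\<open>sum_paths_eq_box_sum\<close>).

  \<^item> On the circle, the determinant in the \<open>a\<close> numbers \<open>z\<^sub>1, 1/z\<^sub>1, \<dots>, z\<^sub>h, 1/z\<^sub>h\<close>
  (and \<open>1\<close> if \<open>a\<close> is odd) vanishes at collisions, including those around the circle.  Multiplied by
  the Cayley transforms of the \<open>z\<^sub>j\<close> and summed over \<open>z\<close>, it yields a function that is constant on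
  all admissible configurations (\<open>cyl_sum_0_alcove\<close>): this sum is a Pfaffian whose entries are the
  signs of the differences of positions.  Hence \<open>cyl_sum\<close> counts the tableaux with free
  end (\<open>card_CSYT\<close>).

  The two sums have the same factor \<open>(c + \<Sum>\<^sub>j (z\<^sub>j + 1/z\<^sub>j)) ^ n\<close>, and at the packed
  configuration they agree term by term (\<open>packed_dets\<close>): the Vandermonde determinant of
  the pairs \<open>z\<^sub>j, 1/z\<^sub>j\<close> contains the square of the Vandermonde determinant of the sums
  \<open>z\<^sub>j + 1/z\<^sub>j\<close>, which is what the two reflected determinants contribute.  This also fixes
  the value of the constant function on the circle without evaluating the Pfaffian.
\<close>

section \<open>Determinants of arrays\<close>

definition ldet :: "nat \<Rightarrow> (nat \<Rightarrow> nat \<Rightarrow> 'a::comm_ring_1) \<Rightarrow> 'a" where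
  "ldet n f = det (mat n n (\<lambda>(i, j). f i j))"

lemma ldet_rows:
  "ldet n f = (\<Sum>p | p permutes {0..<n}. signof p * (\<Prod>i<n. f i (p i)))"
proof -
  have "(\<Prod>i = 0..<n. mat n n (\<lambda>(i, j). f i j) $$ (i, p i)) = (\<Prod>i<n. f i (p i))"
    if "p permutes {0..<n}" for p
    using permutes_in_image[OF that]
    by (auto simp: atLeast0LessThan intro!: prod.cong)
  then show ?thesis
    unfolding ldet_def by (subst det_def'[of _ n]) (auto intro!: sum.cong)
qed

lemma ldet_cols:
  "ldet n f = (\<Sum>p | p permutes {0..<n}. signof p * (\<Prod>j<n. f (p j) j))"
proof -
  have "(\<Prod>i<n. mat n n (\<lambda>(i, j). f i j) $$ (p i, i)) = (\<Prod>i<n. f (p i) i)"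
    if "p permutes {0..<n}" for p
    using permutes_in_image[OF that]
    by (auto simp: atLeast0LessThan intro!: prod.cong)
  then show ?thesis
    unfolding ldet_def by (subst det_col[of _ n]) (auto intro!: sum.cong)
qed

lemma ldet_cong:
  assumes "\<And>i j. i < n \<Longrightarrow> j < n \<Longrightarrow> f i j = g i j"
  shows "ldet n f = ldet n g"
  unfolding ldet_def using assms by (intro arg_cong[where f = det] eq_matI) auto

lemma ldet_transpose: "ldet n (\<lambda>i j. f j i) = ldet n f"
  by (simp only: ldet_rows[of n f] ldet_cols[of n "\<lambda>i j. f j i"])

lemma prod_fun_upd_row:
  fixes f :: "nat \<Rightarrow> nat \<Rightarrow> 'a::comm_monoid_mult"
  assumes "i < n"
  shows "(\<Prod>k<n. (f(i := r)) k (p k)) = r (p i) * (\<Prod>k\<in>{..<n} - {i}. f k (p k))"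
  using assms by (subst prod.remove[of _ i]) (auto intro!: arg_cong2[where f = "(*)"] prod.cong)

lemma ldet_row_add:
  assumes "i < n"
  shows "ldet n (f(i := \<lambda>k. r k + s k)) = ldet n (f(i := r)) + ldet n (f(i := s))"
  unfolding ldet_rows prod_fun_upd_row[OF assms]
  by (simp add: algebra_simps sum.distrib)

lemma ldet_row_smult:
  assumes "i < n"
  shows "ldet n (f(i := \<lambda>k. t * r k)) = t * ldet n (f(i := r))"
  unfolding ldet_rows prod_fun_upd_row[OF assms] sum_distrib_left
  by (simp add: algebra_simps)

lemma ldet_zero_row:
  assumes "i < n" "\<And>k. k < n \<Longrightarrow> f i k = 0"
  shows "ldet n f = 0"
proof -
  have "(\<Prod>k<n. f k (p k)) = 0" if "p permutes {0..<n}" for p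
    using assms permutes_in_image[OF that, of i] by (intro prod_zero) auto
  then show ?thesis unfolding ldet_rows by simp
qed

lemma ldet_identical_rows:
  assumes "i < n" "j < n" "i \<noteq> j" "\<And>k. k < n \<Longrightarrow> f i k = f j k"
  shows "ldet n f = 0"
  unfolding ldet_def
  using assms by (intro det_identical_rows[of _ n i j]) (auto intro!: eq_vecI)

lemma ldet_proportional_rows:
  assumes "i < n" "j < n" "i \<noteq> j" "\<And>k. k < n \<Longrightarrow> f i k = t * f j k"
  shows "ldet n f = 0"
proof -
  have "ldet n f = ldet n (f(i := \<lambda>k. t * f j k))"
    using assms by (intro ldet_cong) auto
  also have "\<dots> = t * ldet n (f(i := f j))"
    using assms by (intro ldet_row_smult) auto
  also have "ldet n (f(i := f j)) = 0"
    using assms by (intro ldet_identical_rows[of i n j]) auto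
  finally show ?thesis by simp
qed

text \<open>
  In the Leibniz expansion every permutation term acquires the factor \<open>\<Sum>i. l (p i)\<close>, which does
  not depend on \<open>p\<close>.  This makes determinants of exponentials eigenfunctions of the sum of
  all single-particle moves.
\<close>

lemma ldet_sum_scaled_rows:
  "(\<Sum>i<n. ldet n (f(i := \<lambda>k. l k * f i k))) = (\<Sum>k<n. l k) * ldet n f"
proof -
  have "ldet n (f(i := \<lambda>k. l k * f i k)) =
      (\<Sum>p | p permutes {0..<n}. l (p i) * (signof p * (\<Prod>k<n. f k (p k))))"
    if "i < n" for i
    unfolding ldet_rows
  proof (rule sum.cong[OF refl])
    fix p
    show "signof p * (\<Prod>k<n. (f(i := \<lambda>k. l k * f i k)) k (p k)) =
        l (p i) * (signof p * (\<Prod>k<n. f k (p k)))"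
      unfolding prod_fun_upd_row[OF that] using that
      by (subst prod.remove[of "{..<n}" i]) (auto simp: algebra_simps)
  qed
  then have "(\<Sum>i<n. ldet n (f(i := \<lambda>k. l k * f i k))) =
      (\<Sum>p | p permutes {0..<n}. \<Sum>i<n. l (p i) * (signof p * (\<Prod>k<n. f k (p k))))"
    by (subst sum.swap) simp
  also have "\<dots> = (\<Sum>p | p permutes {0..<n}. (\<Sum>k<n. l k) * (signof p * (\<Prod>k<n. f k (p k))))"
  proof (rule sum.cong[OF refl])
    fix p :: "nat \<Rightarrow> nat"
    assume "p \<in> {p. p permutes {0..<n}}"
    then have eq: "(\<Sum>i<n. l (p i)) = (\<Sum>k<n. l k)"
      using sum.permute[of p "{0..<n}" l] by (simp add: atLeast0LessThan o_def)
    show "(\<Sum>i<n. l (p i) * (signof p * (\<Prod>k<n. f k (p k)))) =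
        (\<Sum>k<n. l k) * (signof p * (\<Prod>k<n. f k (p k)))"
      unfolding sum_distrib_right[symmetric, of "\<lambda>i. l (p i)"] eq ..
  qed
  finally show ?thesis
    unfolding ldet_rows[of n f] by (simp add: sum_distrib_left)
qed

lemma ldet_permute_cols:
  assumes "q permutes {0..<n}"
  shows "ldet n (\<lambda>i j. f i (q j)) = signof q * ldet n f"
proof -
  have "ldet n (\<lambda>i j. f i (q j)) = ldet n (\<lambda>i j. f j (q i))"
    by (rule ldet_transpose[symmetric])
  also have "\<dots> = det (mat n n (\<lambda>(i, j). mat n n (\<lambda>(i, j). f j i) $$ (q i, j)))"
    unfolding ldet_def using permutes_in_image[OF assms]
    by (intro arg_cong[where f = det] eq_matI) auto
  also have "\<dots> = signof q * ldet n (\<lambda>i j. f j i)"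
    unfolding ldet_def by (rule det_permute_rows) (use assms in auto)
  finally show ?thesis by (simp only: ldet_transpose[of n f])
qed

text \<open>
  Andreief's identity: expanding the second determinant, each permutation of its columns can be moved
  to the columns of the first one, where it contributes the same sign again.
\<close>

lemma andreief:
  fixes f g :: "nat \<Rightarrow> 'b \<Rightarrow> 'a::{comm_ring_1,semiring_char_0}"
  assumes "finite R"
  shows "(\<Sum>z\<in>PiE {..<n} (\<lambda>_. R). ldet n (\<lambda>i j. f i (z j)) * ldet n (\<lambda>i j. g i (z j))) =
    fact n * ldet n (\<lambda>i k. \<Sum>z\<in>R. f i z * g k z)" (is "?L = _")
proof -
  let ?P = "{p. p permutes {0..<n}}"
  define G where "G = (\<lambda>i k. \<Sum>z\<in>R. f i z * g k z)"
  have "?L = (\<Sum>z\<in>PiE {..<n} (\<lambda>_. R). \<Sum>q\<in>?P. \<Sum>p\<in>?P.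
      signof p * signof q * (\<Prod>j<n. f (p j) (z j) * g (q j) (z j)))"
    unfolding ldet_cols sum_product
    by (subst sum.swap) (simp add: prod.distrib algebra_simps)
  also have "\<dots> = (\<Sum>q\<in>?P. \<Sum>p\<in>?P. \<Sum>z\<in>PiE {..<n} (\<lambda>_. R).
      signof p * signof q * (\<Prod>j<n. f (p j) (z j) * g (q j) (z j)))"
    by (subst sum.swap, rule sum.cong[OF refl], rule sum.swap)
  also have "\<dots> = (\<Sum>q\<in>?P. \<Sum>p\<in>?P. signof q * (signof p * (\<Prod>j<n. G (p j) (q j))))"
    unfolding G_def by (simp add: prod_sum_PiE[OF _ assms] sum_distrib_left mult_ac assms)
  also have "\<dots> = (\<Sum>q\<in>?P. signof q * ldet n (\<lambda>i j. G i (q j)))"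
    unfolding ldet_cols by (simp add: sum_distrib_left)
  also have "\<dots> = (\<Sum>q\<in>?P. ldet n G)"
  proof (rule sum.cong[OF refl])
    fix q :: "nat \<Rightarrow> nat" assume "q \<in> ?P"
    then have "ldet n (\<lambda>i j. G i (q j)) = signof q * ldet n G"
      by (intro ldet_permute_cols) simp
    moreover have "signof q * signof q = (1 :: 'a)"
      by (simp add: sign_def)
    ultimately show "signof q * ldet n (\<lambda>i j. G i (q j)) = ldet n G"
      by (metis mult.assoc mult_1)
  qed
  also have "\<dots> = fact n * ldet n G"
    using card_permutations[of "{0..<n}" n] by simp
  finally show ?thesis unfolding G_def .
qed

text \<open>
  Passing from one family of monic polynomials to another multiplies the matrix by a unitriangular one,
  so the determinant is that of the Newton family \<open>\<Prod>k<i. (X - u k)\<close>, whose matrix is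
  triangular.
\<close>

lemma ldet_monic_polys:
  fixes u :: "nat \<Rightarrow> 'a::idom"
  assumes "\<And>i. degree (p i) = i" "\<And>i. coeff (p i) i = 1"
  shows "ldet n (\<lambda>i j. poly (p i) (u j)) = (\<Prod>j<n. \<Prod>i<j. u j - u i)"
proof -
  have vander: "ldet n (\<lambda>i j. poly (q i) (u j)) = ldet n (\<lambda>i j. u j ^ i)"
    if q1: "\<And>i. degree (q i) = i" and q2: "\<And>i. coeff (q i) i = 1" for q
  proof -
    have q3: "coeff (q i) k = 0" if "i < k" for i k
      using that q1[of i] by (intro coeff_eq_0) simp
    define L where "L = mat n n (\<lambda>(i, k). coeff (q i) k)"
    define V where "V = mat n n (\<lambda>(k, j). u j ^ k)"
    have "mat n n (\<lambda>(i, j). poly (q i) (u j)) = L * V"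
    proof (rule eq_matI)
      fix i j assume "i < dim_row (L * V)" "j < dim_col (L * V)"
      then have ij: "i < n" "j < n" by (auto simp: L_def V_def)
      have "poly (q i) (u j) = (\<Sum>k\<le>i. coeff (q i) k * u j ^ k)"
        unfolding poly_altdef q1 ..
      also have "\<dots> = (\<Sum>k<n. coeff (q i) k * u j ^ k)"
        using ij by (intro sum.mono_neutral_left) (auto simp: q3)
      also have "\<dots> = (L * V) $$ (i, j)"
        using ij by (simp add: L_def V_def scalar_prod_def atLeast0LessThan)
      finally show "mat n n (\<lambda>(i, j). poly (q i) (u j)) $$ (i, j) = (L * V) $$ (i, j)"
        using ij by simp
    qed (auto simp: L_def V_def)
    moreover have "det L = 1"
    proof -
      have "det L = prod_list (diag_mat L)"
        by (rule det_lower_triangular[of n]) (auto simp: L_def q3)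
      also have "diag_mat L = map (\<lambda>_. 1) [0..<n]"
        unfolding diag_mat_def L_def by (auto simp: q2)
      finally show ?thesis by (simp add: map_replicate_const)
    qed
    moreover have "det (L * V) = det L * det V"
      by (rule det_mult[of _ n]) (auto simp: L_def V_def)
    ultimately show ?thesis unfolding ldet_def V_def by simp
  qed
  \<comment> \<open>the Newton basis belonging to the points themselves makes the matrix triangular\<close>
  define r where "r = (\<lambda>i. \<Prod>k<i. [:- u k, 1:])"
  have deg: "degree (r i) = i" for i
    unfolding r_def by (subst degree_prod_eq_sum_degree) auto
  have "lead_coeff (r i) = 1" for i
    unfolding r_def lead_coeff_prod by simp
  then have lead: "coeff (r i) i = 1" for i
    by (simp add: deg)
  have "ldet n (\<lambda>i j. poly (p i) (u j)) = ldet n (\<lambda>i j. poly (r i) (u j))"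
    using vander[OF assms] vander[OF deg lead] by simp
  also have "\<dots> = prod_list (diag_mat (mat n n (\<lambda>(i, j). poly (r i) (u j))))"
    unfolding ldet_def
    by (rule det_upper_triangular[of _ n])
      (auto simp: poly_prod r_def upper_triangular_def intro!: prod_zero)
  also have "\<dots> = (\<Prod>j<n. \<Prod>i<j. u j - u i)"
    by (simp add: diag_mat_def poly_prod r_def prod.list_conv_set_nth atLeast0LessThan)
  finally show ?thesis .
qed

section \<open>Reflected determinants on a line\<close>

lemma ldet_scale_cols:
  "ldet n (\<lambda>i j. t j * f i j) = (\<Prod>j<n. t j) * ldet n f"
  unfolding ldet_cols by (simp add: prod.distrib sum_distrib_left mult_ac)

text \<open>
  Chebyshev-like polynomials in \<open>u = z + 1/z\<close>.  For \<open>e = 0\<close> they are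
  \<open>(z ^ (k+1) - z ^ -(k+1)) / (z - 1/z)\<close> and for \<open>e = 1\<close> they are
  \<open>(z ^ (k+1) + z ^ -k) / (z + 1)\<close>.
\<close>

fun cheb :: "nat \<Rightarrow> nat \<Rightarrow> complex poly" where
  "cheb e 0 = 1"
| "cheb e (Suc 0) = [:- of_nat e, 1:]"
| "cheb e (Suc (Suc k)) = [:0, 1:] * cheb e (Suc k) - cheb e k"

lemma cheb_monic: "degree (cheb e k) = k \<and> coeff (cheb e k) k = 1"
proof (induction e k rule: cheb.induct)
  case (3 e k)
  have "coeff (cheb e k) (Suc (Suc k)) = 0"
    using 3 by (intro coeff_eq_0) simp
  then have lead: "coeff (cheb e (Suc (Suc k))) (Suc (Suc k)) = 1"
    using 3 by simp
  have "degree (cheb e (Suc (Suc k))) \<le> Suc (Suc k)"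
    using 3 unfolding cheb.simps
    by (intro degree_diff_le degree_pCons_le order_trans[OF degree_mult_le]) auto
  moreover have "Suc (Suc k) \<le> degree (cheb e (Suc (Suc k)))"
    by (rule le_degree) (use lead in simp)
  ultimately have "degree (cheb e (Suc (Suc k))) = Suc (Suc k)" by (rule antisym)
  then show ?case using lead by (rule conjI)
qed auto

text \<open>
  The parities of the two parameters of a cylindric tableau are recorded by \<open>c\<close> and \<open>gm\<close>:
  \<open>c = 1\<close> means that \<open>a\<close> is odd and \<open>gm = 1\<close> that \<open>b\<close> is even.
\<close>

locale cylinder =
  fixes h w c gm :: nat
  assumes h_pos: "h > 0" and w_pos: "w > 0" and c_le: "c \<le> 1" and gm_le: "gm \<le> 1"
begin

definition "a = 2 * h + c"
definition "b = 2 * w + 1 - gm"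
definition "N = a + b"
definition "M = h + w"
definition "e = 1 - c"
text \<open>
  A determinant of \<open>a\<close> columns that is periodic up to this factor in each variable is invariant
  under moving the first of \<open>a\<close> ordered positions by \<open>N\<close> to become the last: the cyclic shift of
  \<open>a\<close> rows has sign \<open>(- 1) ^ (a - 1)\<close>.
\<close>

definition twist :: complex where "twist = (if c = 1 then 1 else -1)"
definition roots :: "complex set" where "roots = {z. z ^ N = twist}"

text \<open>
  One-particle eigenfunctions on the sites \<open>1, \<dots>, M\<close>.  The reflection is \<open>x \<mapsto> e - x\<close>, with sign
  \<open>-\<close> for odd \<open>a\<close> (a wall at \<open>0\<close>) and sign \<open>+\<close> for even \<open>a\<close>
  (a mirror between \<open>0\<close> and \<open>1\<close>).
\<close>

definition phi :: "int \<Rightarrow> complex \<Rightarrow> complex" where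
  "phi x z = z powi x - twist * z powi (int e - x)"

text \<open>
  The factor \<open>fact h\<close> comes from Andreief's identity and \<open>2 * N\<close> from the norm of \<open>phi\<close>.
\<close>

definition normalizer :: complex where "normalizer = 1 / (fact h * of_nat (2 * N) ^ h)"

definition root_tuples :: "(nat \<Rightarrow> complex) set" where "root_tuples = PiE {..<h} (\<lambda>_. roots)"

definition eigval :: "(nat \<Rightarrow> complex) \<Rightarrow> complex" where
  "eigval z = of_nat c + (\<Sum>j<h. z j + inverse (z j))"

lemma c_cases: "c = 0 \<or> c = 1" using c_le by auto
lemma gm_cases: "gm = 0 \<or> gm = 1" using gm_le by auto

lemma N_eq: "N + gm = 2 * M + 1 + c"
  using gm_le w_pos unfolding N_def a_def b_def M_def by auto

lemma N_pos: "N > 0" using h_pos by (simp add: N_def a_def)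

lemma twist_sq: "twist * twist = 1" by (simp add: twist_def)
lemma twist_nz: "twist \<noteq> 0" by (simp add: twist_def)

lemma roots_nz: "z \<in> roots \<Longrightarrow> z \<noteq> 0"
  using N_pos twist_nz by (auto simp: roots_def power_0_left)

lemma root_tuples_nz: "z \<in> root_tuples \<Longrightarrow> j < h \<Longrightarrow> z j \<noteq> 0"
  unfolding root_tuples_def by (rule roots_nz) auto

lemma root_tuples_roots: "z \<in> root_tuples \<Longrightarrow> j < h \<Longrightarrow> z j \<in> roots"
  unfolding root_tuples_def by auto

lemma finite_roots: "finite roots"
  unfolding roots_def by (rule finite_nth_roots[OF N_pos])

lemma card_roots: "card roots = N"
  unfolding roots_def using card_nth_roots[OF twist_nz N_pos] .

lemma roots_inverse: "z \<in> roots \<Longrightarrow> inverse z \<in> roots"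
  using twist_sq by (auto simp: roots_def power_inverse twist_def)

lemma roots_powi_N: "z \<in> roots \<Longrightarrow> z powi (x + int N) = twist * z powi x"
  using roots_nz[of z] by (simp add: power_int_add roots_def)

text \<open>
  The roots are permuted by multiplication with a primitive \<open>N\<close>-th root of unity \<open>t\<close>,
  so the sum is invariant under multiplication by \<open>t powi d\<close>, which is not \<open>1\<close>.
\<close>

lemma sum_roots_powi:
  assumes "\<bar>d\<bar> < int N"
  shows "(\<Sum>z\<in>roots. z powi d) = (if d = 0 then of_nat N else 0)"
proof (cases "d = 0")
  case True
  then show ?thesis by (simp add: card_roots)
next
  case False
  define t where "t = cis (2 * pi / real N)"
  have tN: "t ^ N = 1"
    using N_pos by (simp add: t_def DeMoivre)
  have t_nz: "t \<noteq> 0" by (simp add: t_def)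
  have "t ^ m \<noteq> 1" if "0 < m" "m < N" for m
  proof
    assume "t ^ m = 1"
    have inj: "inj_on (\<lambda>k. cis (2 * pi * real k / real N)) {..<N}"
      using bij_betw_roots_unity[OF N_pos] by (rule bij_betw_imp_inj_on)
    have "cis (2 * pi * real m / real N) = cis (2 * pi * real 0 / real N)"
      using \<open>t ^ m = 1\<close> by (simp add: t_def DeMoivre algebra_simps)
    from inj_onD[OF inj this] that N_pos show False by simp
  qed
  then have "t ^ nat \<bar>d\<bar> \<noteq> 1" using False assms by simp
  then have td: "t powi d \<noteq> 1"
    using t_nz by (cases "d \<ge> 0") (auto simp: power_int_def power_inverse inverse_eq_1_iff)
  have bij: "bij_betw (\<lambda>z. t * z) roots roots"
    by (rule bij_betw_byWitness[where f' = "\<lambda>z. inverse t * z"])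
      (use tN t_nz in \<open>auto simp: roots_def power_mult_distrib power_inverse field_simps\<close>)
  have "(\<Sum>z\<in>roots. z powi d) = (\<Sum>z\<in>roots. (t * z) powi d)"
    by (rule sum.reindex_bij_betw[OF bij, symmetric])
  also have "\<dots> = t powi d * (\<Sum>z\<in>roots. z powi d)"
    by (simp add: power_int_mult_distrib sum_distrib_left)
  finally show ?thesis using td False by (simp add: field_simps)
qed

lemma sum_roots_inverse: "(\<Sum>z\<in>roots. f (inverse z)) = (\<Sum>z\<in>roots. f z)"
proof (rule sum.reindex_bij_betw)
  show "bij_betw inverse roots roots"
    by (rule bij_betw_byWitness[where f' = inverse]) (auto intro: roots_inverse)
qed

lemma phi_neighbours:
  "z \<noteq> 0 \<Longrightarrow> phi (x + 1) z + phi (x - 1) z = (z + inverse z) * phi x z"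
  unfolding phi_def
  by (simp add: power_int_add power_int_diff power_int_minus field_simps)

lemma phi_bottom: "z \<noteq> 0 \<Longrightarrow> phi 0 z = of_nat e * phi 1 z"
  using c_cases by (auto simp: phi_def e_def twist_def power_int_minus)

text \<open>
  Since \<open>z ^ N = twist\<close>, the reflection at the lower end combined with the period gives a reflection
  at the upper end; its centre is \<open>M + 1\<close> if \<open>gm = 0\<close> and \<open>M + 1/2\<close> if \<open>gm = 1\<close>.
\<close>

lemma phi_top:
  assumes "z \<in> roots"
  shows "phi (int M + 1) z = - of_nat gm * phi (int M) z"
proof -
  have refl: "twist * z powi (int e - x) = z powi (int e - x + int N)" for x
    using roots_powi_N[OF assms] by simp
  have "int N + int gm = 2 * int M + 1 + int c" using N_eq by linarith
  moreover have "int e + int c = 1" using c_cases by (auto simp: e_def)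
  ultimately have ex: "int e - (int M + 1) + int N = int M + 1 - int gm"
    "int e - int M + int N = int M + 2 - int gm" by linarith+
  show ?thesis unfolding phi_def refl ex using gm_cases by (auto simp: add.commute)
qed

text \<open>
  In the product of the two functions the exponents are \<open>\<plusminus>(x - y)\<close> and \<open>\<plusminus>(x + y - e)\<close>; all of them
  are smaller than \<open>N\<close> in absolute value, and the latter are never \<open>0\<close>.
\<close>

lemma sum_roots_phi:
  assumes "1 \<le> x" "x \<le> int M" "1 \<le> y" "y \<le> int M"
  shows "(\<Sum>z\<in>roots. phi x z * phi y (inverse z)) = (if x = y then of_nat (2 * N) else 0)"
proof -
  have N: "int N + int gm = 2 * int M + 1 + int c" using N_eq by linarith
  have ec: "int e + int c = 1" using c_cases by (auto simp: e_def)
  have "phi x z * phi y (inverse z) = z powi (x - y) + z powi (y - x)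
      - twist * z powi (x + y - int e) - twist * z powi (int e - x - y)" if "z \<in> roots" for z
    using roots_nz[OF that] twist_sq unfolding phi_def
    by (simp add: power_int_add power_int_diff power_int_minus power_int_inverse field_simps)
  then have "(\<Sum>z\<in>roots. phi x z * phi y (inverse z)) =
      (\<Sum>z\<in>roots. z powi (x - y)) + (\<Sum>z\<in>roots. z powi (y - x))
      - twist * (\<Sum>z\<in>roots. z powi (x + y - int e)) - twist * (\<Sum>z\<in>roots. z powi (int e - x - y))"
    by (simp add: sum.distrib sum_subtractf sum_distrib_left)
  also have "(\<Sum>z\<in>roots. z powi (x - y)) = (if x = y then of_nat N else 0)"
    using assms N gm_le by (subst sum_roots_powi) auto
  also have "(\<Sum>z\<in>roots. z powi (y - x)) = (if x = y then of_nat N else 0)"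
    using assms N gm_le by (subst sum_roots_powi) auto
  also have "(\<Sum>z\<in>roots. z powi (x + y - int e)) = 0"
    using assms N gm_le ec by (subst sum_roots_powi) auto
  also have "(\<Sum>z\<in>roots. z powi (int e - x - y)) = 0"
    using assms N gm_le ec by (subst sum_roots_powi) auto
  finally show ?thesis by simp
qed

text \<open>
  The spectral expansion of the number of \<open>n\<close>-step walks from \<open>x\<close> to the packed configuration
  \<open>1, \<dots>, h\<close>.
\<close>

definition box_sum :: "nat \<Rightarrow> (nat \<Rightarrow> int) \<Rightarrow> complex" where
  "box_sum n x = normalizer * (\<Sum>z\<in>root_tuples. ldet h (\<lambda>i j. phi (x i) (z j)) *
     ldet h (\<lambda>i j. phi (int i + 1) (inverse (z j))) * eigval z ^ n)"

lemma box_sum_cong: "(\<And>i. i < h \<Longrightarrow> x i = y i) \<Longrightarrow> box_sum n x = box_sum n y"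
  unfolding box_sum_def
  by (intro arg_cong[where f = "\<lambda>s. normalizer * s"] sum.cong refl
      arg_cong2[where f = "(*)"] ldet_cong) auto

lemma box_sum_linear:
  assumes "\<And>z. z \<in> root_tuples \<Longrightarrow> ldet h (\<lambda>i j. phi (x i) (z j)) = t * ldet h (\<lambda>i j. phi (y i) (z j))"
  shows "box_sum n x = t * box_sum n y"
  unfolding box_sum_def using assms by (simp add: sum_distrib_left mult_ac)

lemma box_sum_equal:
  assumes "i < h" "k < h" "i \<noteq> k" "x i = x k"
  shows "box_sum n x = 0"
proof -
  have "ldet h (\<lambda>i j. phi (x i) (z j)) = 0" for z
    using assms by (intro ldet_identical_rows[of i h k]) auto
  then show ?thesis by (simp add: box_sum_def)
qed

lemma phi_upd: "(\<lambda>i j. phi ((x(k := m)) i) (z j)) = (\<lambda>i j. phi (x i) (z j))(k := \<lambda>j. phi m (z j))"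
  by auto

lemma box_sum_bottom:
  assumes "k < h"
  shows "box_sum n (x(k := 0)) = of_nat e * box_sum n (x(k := 1))"
proof (rule box_sum_linear)
  fix z assume z: "z \<in> root_tuples"
  have "ldet h (\<lambda>i j. phi ((x(k := 0)) i) (z j)) =
      ldet h ((\<lambda>i j. phi (x i) (z j))(k := \<lambda>j. of_nat e * phi 1 (z j)))"
    by (intro ldet_cong) (auto simp: phi_bottom root_tuples_nz[OF z])
  then show "ldet h (\<lambda>i j. phi ((x(k := 0)) i) (z j)) =
      of_nat e * ldet h (\<lambda>i j. phi ((x(k := 1)) i) (z j))"
    unfolding phi_upd ldet_row_smult[OF assms] by simp
qed

lemma box_sum_top:
  assumes "k < h"
  shows "box_sum n (x(k := int M + 1)) = - of_nat gm * box_sum n (x(k := int M))"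
proof (rule box_sum_linear)
  fix z assume z: "z \<in> root_tuples"
  have "ldet h (\<lambda>i j. phi ((x(k := int M + 1)) i) (z j)) =
      ldet h ((\<lambda>i j. phi (x i) (z j))(k := \<lambda>j. - of_nat gm * phi (int M) (z j)))"
    by (intro ldet_cong) (auto simp: phi_top root_tuples_roots[OF z])
  then show "ldet h (\<lambda>i j. phi ((x(k := int M + 1)) i) (z j)) =
      - of_nat gm * ldet h (\<lambda>i j. phi ((x(k := int M)) i) (z j))"
    unfolding phi_upd ldet_row_smult[OF assms] by simp
qed

lemma box_sum_step:
  "box_sum (Suc n) x = of_nat c * box_sum n x + (\<Sum>i<h. box_sum n (x(i := x i + 1)) + box_sum n (x(i := x i - 1)))"
proof -
  define D where "D = (\<lambda>x z. ldet h (\<lambda>i j. phi (x i) (z j)))"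
  define D' where "D' = (\<lambda>z. ldet h (\<lambda>i j. phi (int i + 1) (inverse (z j))))"
  have box_sum: "box_sum n x = normalizer * (\<Sum>z\<in>root_tuples. D x z * D' z * eigval z ^ n)" for n x
    unfolding box_sum_def D_def D'_def ..
  have neighbours: "(\<Sum>i<h. D (x(i := x i + 1)) z + D (x(i := x i - 1)) z) = (eigval z - of_nat c) * D x z"
    if z: "z \<in> root_tuples" for z
  proof -
    have "D (x(i := x i + 1)) z + D (x(i := x i - 1)) z =
        ldet h ((\<lambda>i j. phi (x i) (z j))(i := \<lambda>j. (z j + inverse (z j)) * phi (x i) (z j)))"
      if "i < h" for i
      unfolding D_def phi_upd ldet_row_add[OF that, symmetric]
      by (intro ldet_cong) (auto simp: phi_neighbours root_tuples_nz[OF z])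
    then show ?thesis
      unfolding eigval_def D_def
      using ldet_sum_scaled_rows[of h "\<lambda>i j. phi (x i) (z j)" "\<lambda>j. z j + inverse (z j)"]
      by simp
  qed
  have "(\<Sum>z\<in>root_tuples. D x z * D' z * eigval z ^ Suc n) = (\<Sum>z\<in>root_tuples. of_nat c * (D x z * D' z * eigval z ^ n) +
      (\<Sum>i<h. D (x(i := x i + 1)) z + D (x(i := x i - 1)) z) * (D' z * eigval z ^ n))"
    by (intro sum.cong refl, simp only: neighbours power_Suc) (simp add: algebra_simps)
  also have "\<dots> = of_nat c * (\<Sum>z\<in>root_tuples. D x z * D' z * eigval z ^ n) +
     (\<Sum>i<h. \<Sum>z\<in>root_tuples. (D (x(i := x i + 1)) z + D (x(i := x i - 1)) z) * (D' z * eigval z ^ n))"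
    unfolding sum.distrib[of _ _ root_tuples] sum_distrib_right[of _ "{..<h}"] sum_distrib_left
    by (subst sum.swap[of _ "{..<h}"]) (rule refl)
  also have "\<dots> = of_nat c * (\<Sum>z\<in>root_tuples. D x z * D' z * eigval z ^ n) +
     (\<Sum>i<h. (\<Sum>z\<in>root_tuples. D (x(i := x i + 1)) z * D' z * eigval z ^ n) +
       (\<Sum>z\<in>root_tuples. D (x(i := x i - 1)) z * D' z * eigval z ^ n))"
    by (simp only: sum.distrib[symmetric] distrib_right mult.assoc)
  finally show ?thesis
    unfolding box_sum by (simp add: algebra_simps sum_distrib_left sum.distrib)
qed

text \<open>
  By Andreief's identity the sum is a determinant of orthogonality relations.  If the increasing
  sequence \<open>x\<close> is not packed, it contains a site beyond \<open>h\<close>, and the corresponding row vanishes.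
\<close>

lemma box_sum_init:
  assumes mono: "\<And>i j. i < j \<Longrightarrow> j < h \<Longrightarrow> x i < x j"
    and range: "\<And>i. i < h \<Longrightarrow> 1 \<le> x i \<and> x i \<le> int M"
  shows "box_sum 0 x = (if \<forall>i<h. x i = int i + 1 then 1 else 0)"
proof -
  let ?G = "\<lambda>i k. if x i = int k + 1 then of_nat (2 * N) else (0 :: complex)"
  have "box_sum 0 x = normalizer * (fact h * ldet h (\<lambda>i k. \<Sum>z\<in>roots. phi (x i) z * phi (int k + 1) (inverse z)))"
    unfolding box_sum_def root_tuples_def
    using andreief[OF finite_roots, of h "\<lambda>i. phi (x i)" "\<lambda>i z. phi (int i + 1) (inverse z)"] by simp
  also have "ldet h (\<lambda>i k. \<Sum>z\<in>roots. phi (x i) z * phi (int k + 1) (inverse z)) = ldet h ?G"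
    using range by (intro ldet_cong) (auto simp: sum_roots_phi M_def)
  finally have box_sum: "box_sum 0 x = normalizer * (fact h * ldet h ?G)" .
  show ?thesis
  proof (cases "\<forall>i<h. x i = int i + 1")
    case True
    then have "ldet h ?G = det (of_nat (2 * N) \<cdot>\<^sub>m 1\<^sub>m h)"
      unfolding ldet_def by (intro arg_cong[where f = det] eq_matI) auto
    also have "\<dots> = of_nat (2 * N) ^ h" by simp
    finally show ?thesis using True N_pos by (simp add: box_sum normalizer_def)
  next
    case False
    have "\<exists>i<h. x i > int h"
    proof (rule ccontr)
      assume small: "\<not> (\<exists>i<h. x i > int h)"
      have lower: "x i \<ge> int i + 1" if "i < h" for i
        using that
      proof (induction i)
        case 0 then show ?case using range by simp
      next
        case (Suc i) then show ?case using mono[of i "Suc i"] by simp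
      qed
      have upper: "x i \<le> int i + 1" if "i < h" for i
        using that
      proof (induction "h - 1 - i" arbitrary: i)
        case 0
        then have "int h = int i + 1" by simp
        moreover have "x i \<le> int h" using small \<open>i < h\<close> by force
        ultimately show ?case by simp
      next
        case (Suc m)
        then have "x (Suc i) \<le> int (Suc i) + 1" by (intro Suc(1)) auto
        moreover have "x i < x (Suc i)" using Suc by (intro mono) auto
        ultimately show ?case by simp
      qed
      from False lower upper show False by force
    qed
    then obtain i where "i < h" "x i > int h" by auto
    then have "ldet h ?G = 0" by (intro ldet_zero_row[of i]) auto
    then show ?thesis using False by (simp add: box_sum)
  qed
qed

end

section \<open>Determinants on a circle\<close>

lemma prod_pairs:
  fixes f :: "nat \<Rightarrow> 'a::comm_monoid_mult"
  shows "(\<Prod>k<2 * m. f k) = (\<Prod>j<m. f (2 * j) * f (Suc (2 * j)))"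
  by (induction m) (simp_all add: mult_ac)

lemma sum_pairs:
  fixes f :: "nat \<Rightarrow> 'a::comm_monoid_add"
  shows "(\<Sum>k<2 * m. f k) = (\<Sum>j<m. f (2 * j) + f (Suc (2 * j)))"
  by (induction m) (simp_all add: add_ac)

text \<open>
  Composition with the transposition is a sign-reversing involution on the terms.
\<close>

lemma alternating_sum_zero:
  fixes f :: "(nat \<Rightarrow> nat) \<Rightarrow> complex"
  assumes "i < n" "j < n" "i \<noteq> j"
    and inv: "\<And>p. p permutes {0..<n} \<Longrightarrow> f (p \<circ> transpose i j) = f p"
  shows "(\<Sum>p | p permutes {0..<n}. signof p * f p) = 0"
proof -
  let ?t = "transpose i j"
  have t: "?t permutes {0..<n}" using assms by (intro permutes_swap_id) auto
  have "(\<Sum>p | p permutes {0..<n}. signof p * f p) =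
      (\<Sum>p | p permutes {0..<n}. signof (p \<circ> ?t) * f (p \<circ> ?t))"
    by (rule sum_permutations_compose_right[OF t])
  also have "\<dots> = (\<Sum>p | p permutes {0..<n}. - (signof p * f p))"
  proof (rule sum.cong[OF refl])
    fix p assume "p \<in> {p. p permutes {0..<n}}"
    then have p: "p permutes {0..<n}" by simp
    have "sign (p \<circ> ?t) = sign p * sign ?t"
      using p t by (intro sign_compose) (auto intro: permutation_permutes[THEN iffD2])
    then show "signof (p \<circ> ?t) * f (p \<circ> ?t) = - (signof p * f p)"
      using inv[OF p] assms(3) by (simp add: sign_swap_id)
  qed
  finally show ?thesis by (simp add: sum_negf)
qed

context cylinder
begin

text \<open>
  The sequence \<open>z\<^sub>0, 1/z\<^sub>0, z\<^sub>1, 1/z\<^sub>1, \<dots>\<close>, followed by \<open>1\<close> if \<open>a\<close> is odd.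
\<close>

definition paired :: "(nat \<Rightarrow> complex) \<Rightarrow> nat \<Rightarrow> complex" where
  "paired z k = (if k < 2 * h then if even k then z (k div 2) else inverse (z (k div 2)) else 1)"

text \<open>
  At \<open>z = 1\<close>, which is a root only for odd \<open>a\<close>, the value is \<open>0\<close> by the convention on division.  This
  is the right value there: it keeps \<open>cayley (1/z) = - cayley z\<close> valid at every root.
\<close>

definition cayley :: "complex \<Rightarrow> complex" where "cayley z = (1 + z) / (1 - z)"

text \<open>
  The spectral expansion of the number of \<open>n\<close>-step walks on the circle with given start and
  arbitrary end.  A step decreases one of the positions; the determinant consists of powers
  of numbers closed under inversion, so the eigenvalue is the same as for increasing steps.
\<close>

definition cyl_sum :: "nat \<Rightarrow> (nat \<Rightarrow> int) \<Rightarrow> complex" where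
  "cyl_sum n y = normalizer * (\<Sum>z\<in>root_tuples. (\<Prod>j<h. cayley (z j)) * ldet a (\<lambda>i k. paired z k powi y i) * eigval z ^ n)"

lemma paired_simps: "j < h \<Longrightarrow> paired z (2 * j) = z j" "j < h \<Longrightarrow> paired z (Suc (2 * j)) = inverse (z j)"
  by (auto simp: paired_def)

lemma paired_nz: "z \<in> root_tuples \<Longrightarrow> paired z k \<noteq> 0"
  using root_tuples_nz[of z "k div 2"] by (auto simp: paired_def)

lemma prod_below_a:
  fixes f :: "nat \<Rightarrow> complex"
  shows "(\<Prod>k<a. f k) = (\<Prod>j<h. f (2 * j) * f (Suc (2 * j))) * (if c = 1 then f (2 * h) else 1)"
  using c_cases unfolding a_def by (auto simp: prod_pairs)

lemma sum_paired: "(\<Sum>k<a. inverse (paired z k)) = eigval z"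
proof -
  have "(\<Sum>k<a. inverse (paired z k)) = (\<Sum>k<2 * h. inverse (paired z k)) + of_nat c"
    using c_cases unfolding a_def by (auto simp: paired_def)
  also have "\<dots> = eigval z"
    unfolding sum_pairs eigval_def by (simp add: paired_simps add_ac)
  finally show ?thesis .
qed

lemma paired_powi_N:
  assumes "z \<in> root_tuples" "k < a"
  shows "paired z k powi (x + int N) = twist * paired z k powi x"
proof (cases "k < 2 * h")
  case True
  then have "paired z k \<in> roots"
    using root_tuples_roots[OF assms(1), of "k div 2"] roots_inverse by (auto simp: paired_def)
  then show ?thesis by (rule roots_powi_N)
next
  case False
  then have "c = 1" using assms(2) c_cases by (auto simp: a_def)
  then show ?thesis using False unfolding paired_def twist_def by simp
qed

lemma cyl_sum_vanish:
  assumes "\<And>z. z \<in> root_tuples \<Longrightarrow> ldet a (\<lambda>i k. paired z k powi y i) = 0"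
  shows "cyl_sum n y = 0"
  unfolding cyl_sum_def using assms by simp

lemma cyl_sum_equal:
  assumes "i < a" "k < a" "i \<noteq> k" "y i = y k"
  shows "cyl_sum n y = 0"
  using assms by (intro cyl_sum_vanish ldet_identical_rows[of i a k]) auto

text \<open>
  All exponents in row \<open>i\<close> exceed those in row \<open>k\<close> by the period, so the rows are
  proportional.
\<close>

lemma cyl_sum_wrap:
  assumes "i < a" "k < a" "i \<noteq> k" "y i = y k + int N"
  shows "cyl_sum n y = 0"
  using assms by (intro cyl_sum_vanish ldet_proportional_rows[of i a k _ twist]) (auto simp: paired_powi_N)

lemma cyl_sum_step: "cyl_sum (Suc n) y = (\<Sum>i<a. cyl_sum n (y(i := y i - 1)))"
proof -
  define D where "D = (\<lambda>y z. ldet a (\<lambda>i k. paired z k powi y i))"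
  define G where "G = (\<lambda>z. \<Prod>j<h. cayley (z j))"
  have cyl_sum: "cyl_sum n y = normalizer * (\<Sum>z\<in>root_tuples. D y z * (G z * eigval z ^ n))" for n y
    unfolding cyl_sum_def D_def G_def by (simp add: mult_ac)
  have shifts: "(\<Sum>i<a. D (y(i := y i - 1)) z) = eigval z * D y z" if z: "z \<in> root_tuples" for z
  proof -
    have "D (y(i := y i - 1)) z =
        ldet a ((\<lambda>i k. paired z k powi y i)(i := \<lambda>k. inverse (paired z k) * paired z k powi y i))" for i
      unfolding D_def using paired_nz[OF z]
      by (intro ldet_cong) (auto simp: power_int_diff field_simps)
    then show ?thesis
      unfolding D_def using ldet_sum_scaled_rows[of a "\<lambda>i k. paired z k powi y i" "\<lambda>k. inverse (paired z k)"]
      by (simp add: sum_paired)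
  qed
  have "(\<Sum>z\<in>root_tuples. D y z * (G z * eigval z ^ Suc n)) =
      (\<Sum>z\<in>root_tuples. (\<Sum>i<a. D (y(i := y i - 1)) z) * (G z * eigval z ^ n))"
    by (intro sum.cong refl) (simp only: shifts, simp add: algebra_simps)
  also have "\<dots> = (\<Sum>i<a. \<Sum>z\<in>root_tuples. D (y(i := y i - 1)) z * (G z * eigval z ^ n))"
    unfolding sum_distrib_right by (rule sum.swap)
  finally show ?thesis unfolding cyl_sum by (simp add: sum_distrib_left)
qed

lemma cheb_phi:
  assumes "z \<noteq> 0"
  shows "poly (cheb e k) (z + inverse z) * phi 1 z = phi (int k + 1) z"
proof (induction k rule: induct_nat_012)
  case 1
  have "phi 2 z + phi 0 z = (z + inverse z) * phi 1 z"
    using phi_neighbours[OF assms, of 1] by simp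
  then show ?case by (simp add: phi_bottom[OF assms] algebra_simps)
next
  case (ge2 k)
  have "phi (int (Suc (Suc k)) + 1) z = (z + inverse z) * phi (int (Suc k) + 1) z - phi (int k + 1) z"
    using phi_neighbours[OF assms, of "int k + 2"] by (simp add: algebra_simps)
  then show ?case
    unfolding ge2[symmetric] by (simp add: algebra_simps)
qed simp

lemma ldet_phi_packed:
  assumes "\<And>j. j < h \<Longrightarrow> z j \<noteq> 0"
  shows "ldet h (\<lambda>i j. phi (int i + 1) (z j)) =
    (\<Prod>j<h. phi 1 (z j)) * (\<Prod>j<h. \<Prod>i<j. (z j + inverse (z j)) - (z i + inverse (z i)))"
proof -
  have "ldet h (\<lambda>i j. phi (int i + 1) (z j)) =
      ldet h (\<lambda>i j. phi 1 (z j) * poly (cheb e i) (z j + inverse (z j)))"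
    using assms by (intro ldet_cong) (simp add: cheb_phi[symmetric] mult.commute)
  also have "\<dots> = (\<Prod>j<h. phi 1 (z j)) * ldet h (\<lambda>i j. poly (cheb e i) (z j + inverse (z j)))"
    by (rule ldet_scale_cols)
  also have "ldet h (\<lambda>i j. poly (cheb e i) (z j + inverse (z j))) =
      (\<Prod>j<h. \<Prod>i<j. (z j + inverse (z j)) - (z i + inverse (z i)))"
    by (rule ldet_monic_polys) (use cheb_monic in auto)
  finally show ?thesis .
qed

text \<open>
  The four factors that two pairs \<open>v, 1/v\<close> and \<open>t, 1/t\<close> contribute multiply to
  \<open>((v + 1/v) - (t + 1/t))\<^sup>2\<close>.
\<close>

lemma vandermonde_pairs:
  fixes zz :: "nat \<Rightarrow> complex"
  assumes "\<And>j. j < m \<Longrightarrow> zz j \<noteq> 0"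
    and Y: "\<And>j. j < m \<Longrightarrow> Y (2 * j) = zz j" "\<And>j. j < m \<Longrightarrow> Y (Suc (2 * j)) = inverse (zz j)"
  shows "(\<Prod>k<2 * m. \<Prod>i<k. Y k - Y i) =
    (\<Prod>j<m. inverse (zz j) - zz j) *
    (\<Prod>j<m. \<Prod>i<j. ((zz j + inverse (zz j)) - (zz i + inverse (zz i)))\<^sup>2)"
  using assms
proof (induction m)
  case (Suc m)
  let ?u = "\<lambda>j. zz j + inverse (zz j)"
  have quad: "(Y (2 * m) - zz j) * (Y (2 * m) - inverse (zz j)) *
      ((Y (Suc (2 * m)) - zz j) * (Y (Suc (2 * m)) - inverse (zz j))) = (?u m - ?u j)\<^sup>2"
    if "j < m" for j
  proof -
    have "(v - t) * (v - inverse t) * ((inverse v - t) * (inverse v - inverse t)) =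
        ((v + inverse v) - (t + inverse t))\<^sup>2" if "v \<noteq> 0" "t \<noteq> 0" for v t :: complex
      using that by (simp add: field_simps power2_eq_square)
    moreover have "zz j \<noteq> 0" "zz m \<noteq> 0" using Suc.prems(1) that by auto
    moreover have "Y (2 * m) = zz m" "Y (Suc (2 * m)) = inverse (zz m)" using Suc.prems(2,3) by auto
    ultimately show ?thesis by simp
  qed
  have below: "(\<Prod>i<2 * m. v - Y i) = (\<Prod>j<m. (v - zz j) * (v - inverse (zz j)))" for v
    unfolding prod_pairs using Suc.prems(2,3) by (intro prod.cong) auto
  have "(\<Prod>k<2 * Suc m. \<Prod>i<k. Y k - Y i) =
      (\<Prod>k<2 * m. \<Prod>i<k. Y k - Y i) * (\<Prod>i<2 * m. Y (2 * m) - Y i) *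
      ((\<Prod>i<2 * m. Y (Suc (2 * m)) - Y i) * (Y (Suc (2 * m)) - Y (2 * m)))"
    by simp
  also have "\<dots> = (\<Prod>k<2 * m. \<Prod>i<k. Y k - Y i) * (inverse (zz m) - zz m) *
      (\<Prod>j<m. (?u m - ?u j)\<^sup>2)"
  proof -
    have "(\<Prod>i<2 * m. Y (2 * m) - Y i) * (\<Prod>i<2 * m. Y (Suc (2 * m)) - Y i) =
        (\<Prod>j<m. (?u m - ?u j)\<^sup>2)"
      unfolding below prod.distrib[symmetric] using quad by (intro prod.cong) auto
    moreover have "Y (2 * m) = zz m" "Y (Suc (2 * m)) = inverse (zz m)"
      using Suc.prems(2,3) by auto
    ultimately show ?thesis by (simp add: mult_ac)
  qed
  also have "(\<Prod>k<2 * m. \<Prod>i<k. Y k - Y i) = (\<Prod>j<m. inverse (zz j) - zz j) *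
      (\<Prod>j<m. \<Prod>i<j. (?u j - ?u i)\<^sup>2)"
    by (rule Suc.IH) (use Suc.prems in auto)
  finally show ?case by (simp add: mult_ac)
qed simp

text \<open>
  Both sides contain the squared Vandermonde product in the \<open>z j + 1 / z j\<close>.  What remains on either
  side is one factor for each \<open>z = z j\<close>, namely \<open>(1 + z)\<^sup>2 / z\<close> for even \<open>a\<close> and
  \<open>- (z - 1/z)\<^sup>2\<close> for odd \<open>a\<close>; the Cayley transform accounts for the difference.
\<close>

lemma packed_dets:
  assumes z: "z \<in> root_tuples"
  shows "(\<Prod>j<h. cayley (z j)) * ldet a (\<lambda>i k. paired z k powi int i) =
    ldet h (\<lambda>i j. phi (int i + 1) (z j)) * ldet h (\<lambda>i j. phi (int i + 1) (inverse (z j)))"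
proof -
  let ?u = "\<lambda>j. z j + inverse (z j)"
  let ?W = "\<Prod>j<h. \<Prod>i<j. (?u j - ?u i)\<^sup>2"
  let ?t = "\<lambda>j. if c = 1 then (1 - z j) * (1 - inverse (z j)) else 1"
  have nz: "\<And>j. j < h \<Longrightarrow> z j \<noteq> 0" by (rule root_tuples_nz[OF z])
  have "ldet a (\<lambda>i k. paired z k powi int i) = ldet a (\<lambda>i k. poly (monom 1 i) (paired z k))"
    by (simp add: poly_monom)
  also have "\<dots> = (\<Prod>k<a. \<Prod>i<k. paired z k - paired z i)"
    by (rule ldet_monic_polys) (auto simp: degree_monom_eq)
  also have "\<dots> = (\<Prod>k<2 * h. \<Prod>i<k. paired z k - paired z i) * (\<Prod>j<h. ?t j)"
  proof (cases "c = 1")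
    case True
    have "(\<Prod>i<2 * h. paired z (2 * h) - paired z i) = (\<Prod>j<h. ?t j)"
      unfolding prod_pairs using True by (intro prod.cong) (auto simp: paired_def)
    then show ?thesis using True unfolding a_def by simp
  next
    case False
    then show ?thesis using c_cases unfolding a_def by simp
  qed
  also have "(\<Prod>k<2 * h. \<Prod>i<k. paired z k - paired z i) = (\<Prod>j<h. inverse (z j) - z j) * ?W"
    by (rule vandermonde_pairs) (use nz paired_simps in auto)
  finally have lhs: "(\<Prod>j<h. cayley (z j)) * ldet a (\<lambda>i k. paired z k powi int i) =
      (\<Prod>j<h. cayley (z j) * (inverse (z j) - z j) * ?t j) * ?W"
    by (simp add: prod.distrib mult_ac)
  have "ldet h (\<lambda>i j. phi (int i + 1) (inverse (z j))) =
    (\<Prod>j<h. phi 1 (inverse (z j))) * (\<Prod>j<h. \<Prod>i<j. ?u j - ?u i)"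
    using ldet_phi_packed[of "\<lambda>j. inverse (z j)"] nz by (simp add: add.commute)
  then have "ldet h (\<lambda>i j. phi (int i + 1) (z j)) * ldet h (\<lambda>i j. phi (int i + 1) (inverse (z j))) =
      (\<Prod>j<h. phi 1 (z j) * phi 1 (inverse (z j))) * ?W"
    using ldet_phi_packed[of z] nz by (simp add: prod.distrib power2_eq_square mult_ac)
  moreover have "cayley (z j) * (inverse (z j) - z j) * ?t j = phi 1 (z j) * phi 1 (inverse (z j))"
    if "j < h" for j
  proof (cases "z j = 1")
    case True
    have "c = 1"
    proof (rule ccontr)
      assume "c \<noteq> 1"
      then show False using root_tuples_roots[OF z that] True by (simp add: roots_def twist_def)
    qed
    then show ?thesis using True unfolding cayley_def phi_def e_def twist_def by simp
  next
    case False
    then show ?thesis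
      using c_cases nz[OF that] unfolding cayley_def phi_def e_def twist_def
      by (auto simp: field_simps)
  qed
  ultimately show ?thesis unfolding lhs by simp
qed

lemma cyl_sum_packed: "cyl_sum n int = box_sum n (\<lambda>i. int i + 1)"
  unfolding cyl_sum_def box_sum_def
  by (intro arg_cong[where f = "\<lambda>s. normalizer * s"] sum.cong refl) (simp only: packed_dets)

text \<open>
  The entries of the Pfaffian: for \<open>\<bar>d\<bar> < N\<close> this is \<open>- N * sgn d\<close>, up to a linear term for odd
  \<open>a\<close>, which is forced by periodicity.
\<close>

definition pair_sum :: "int \<Rightarrow> complex" where "pair_sum d = (\<Sum>z\<in>roots. cayley z * z powi d)"

lemma one_in_roots: "1 \<in> roots \<longleftrightarrow> c = 1"
  using c_cases by (auto simp: roots_def twist_def)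

lemma pair_sum_minus: "pair_sum (- d) = - pair_sum d"
proof -
  have "pair_sum (- d) = (\<Sum>z\<in>roots. cayley (inverse z) * z powi d)"
    unfolding pair_sum_def using sum_roots_inverse[of "\<lambda>z. cayley z * z powi (- d)"]
    by (simp add: power_int_minus power_int_inverse)
  also have "\<dots> = (\<Sum>z\<in>roots. - (cayley z * z powi d))"
  proof (intro sum.cong refl)
    fix z assume "z \<in> roots"
    then have "z \<noteq> 0" by (rule roots_nz)
    then have "cayley (inverse z) = - cayley z"
      by (cases "z = 1") (auto simp: cayley_def divide_simps, auto simp: algebra_simps)
    then show "cayley (inverse z) * z powi d = - (cayley z * z powi d)" by simp
  qed
  finally show ?thesis by (simp add: pair_sum_def sum_negf)
qed

text \<open>
  Multiplication by \<open>1 - z\<close> turns the Cayley transform into \<open>1 + z\<close>, except at the root \<open>z = 1\<close>,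
  where the term \<open>2\<close> is missing.
\<close>

lemma pair_sum_step:
  assumes "0 \<le> d" "d + 1 < int N"
  shows "pair_sum d - pair_sum (d + 1) = (if d = 0 then of_nat N else 0) - 2 * of_nat c"
proof -
  have "pair_sum d - pair_sum (d + 1) = (\<Sum>z\<in>roots. (z powi d + z powi (d + 1)) - (if z = 1 then 2 else 0))"
    unfolding pair_sum_def sum_subtractf[symmetric]
    using roots_nz by (intro sum.cong) (auto simp: cayley_def power_int_add field_simps)
  also have "\<dots> = (if d = 0 then of_nat N else 0) - (if 1 \<in> roots then 2 else 0)"
    using assms finite_roots by (simp add: sum_subtractf sum.distrib sum_roots_powi sum.delta')
  finally show ?thesis using c_cases by (auto simp: one_in_roots)
qed

lemma pair_sum_pos:
  assumes "0 < d" "d < int N"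
  shows "pair_sum d = 2 * of_nat c * of_int d - of_nat N"
proof -
  have zero: "pair_sum 0 = 0" using pair_sum_minus[of 0] by simp
  have "pair_sum (int (Suc m)) = 2 * of_nat c * of_nat (Suc m) - of_nat N" if "Suc m < N" for m
    using that
  proof (induction m)
    case 0
    then show ?case using pair_sum_step[of 0] by (simp add: zero algebra_simps)
  next
    case (Suc m)
    have "pair_sum (int (Suc (Suc m))) = pair_sum (int (Suc m)) + 2 * of_nat c"
      using pair_sum_step[of "int (Suc m)"] Suc.prems by (simp add: algebra_simps)
    then show ?case using Suc by (simp add: algebra_simps)
  qed
  from this[of "nat d - 1"] assms show ?thesis by (cases d) auto
qed

lemma pair_sum_eq:
  assumes "\<bar>d\<bar> < int N"
  shows "pair_sum d = 2 * of_nat c * of_int d - of_nat N * of_int (sgn d)"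
proof -
  consider "d = 0" | "d > 0" | "d < 0" by linarith
  then show ?thesis
  proof cases
    case 1 then show ?thesis using pair_sum_minus[of 0] by simp
  next
    case 2 then show ?thesis using pair_sum_pos[of d] assms by simp
  next
    case 3
    have "pair_sum d = - pair_sum (- d)" by (simp add: pair_sum_minus)
    then show ?thesis using 3 pair_sum_pos[of "- d"] assms by simp
  qed
qed

text \<open>
  In the Leibniz expansion the columns \<open>2 * j\<close> and \<open>2 * j + 1\<close> carry \<open>z j\<close> and its inverse, so the sum
  over \<open>z\<close> factors over \<open>j\<close>.  The result is the expansion of a Pfaffian as a sum over
  permutations, bordered by a row of ones if \<open>a\<close> is odd.
\<close>

lemma cyl_sum_0_expand:
  "cyl_sum 0 y = normalizer * (\<Sum>p | p permutes {0..<a}. signof p *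
     (\<Prod>j<h. pair_sum (y (p (2 * j)) - y (p (Suc (2 * j))))))"
proof -
  have "cyl_sum 0 y = normalizer * (\<Sum>z\<in>root_tuples. \<Sum>p | p permutes {0..<a}. signof p *
      (\<Prod>j<h. cayley (z j) * z j powi (y (p (2 * j)) - y (p (Suc (2 * j))))))"
  proof -
    have "(\<Prod>j<h. cayley (z j)) * (\<Prod>k<a. paired z k powi y (p k)) =
        (\<Prod>j<h. cayley (z j) * z j powi (y (p (2 * j)) - y (p (Suc (2 * j)))))" if z: "z \<in> root_tuples" for z p
    proof -
      have "(\<Prod>k<a. paired z k powi y (p k)) =
          (\<Prod>j<h. paired z (2 * j) powi y (p (2 * j)) * paired z (Suc (2 * j)) powi y (p (Suc (2 * j))))"
        by (simp add: prod_below_a paired_def)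
      also have "\<dots> = (\<Prod>j<h. z j powi (y (p (2 * j)) - y (p (Suc (2 * j)))))"
        using root_tuples_nz[OF z]
        by (intro prod.cong refl) (auto simp: paired_simps power_int_diff power_int_inverse divide_inverse)
      finally show ?thesis by (simp add: prod.distrib)
    qed
    then show ?thesis
      unfolding cyl_sum_def ldet_cols
      by (intro arg_cong[where f = "\<lambda>s. normalizer * s"] sum.cong) (auto simp: sum_distrib_left mult_ac)
  qed
  also have "\<dots> = normalizer * (\<Sum>p | p permutes {0..<a}. signof p * (\<Sum>z\<in>root_tuples.
      (\<Prod>j<h. cayley (z j) * z j powi (y (p (2 * j)) - y (p (Suc (2 * j)))))))"
    by (subst sum.swap) (simp add: sum_distrib_left)
  also have "\<dots> = normalizer * (\<Sum>p | p permutes {0..<a}. signof p *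
      (\<Prod>j<h. pair_sum (y (p (2 * j)) - y (p (Suc (2 * j))))))"
    unfolding root_tuples_def pair_sum_def by (simp add: prod_sum_PiE finite_roots)
  finally show ?thesis .
qed

text \<open>
  For odd \<open>a\<close> the index \<open>2 * h\<close> is unpaired and carries the factor \<open>1\<close>.  A term depending on
  \<open>p (2 * m)\<close> but not on \<open>p (Suc (2 * m))\<close> is therefore invariant under exchanging the
  values at \<open>Suc (2 * m)\<close> and \<open>2 * h\<close>, and cancels; similarly with the two roles interchanged.
\<close>

lemma linear_terms_cancel:
  assumes m: "m < h"
    and f: "\<And>p q. (\<And>k. k \<notin> {2 * m, Suc (2 * m), 2 * h} \<Longrightarrow> p k = q k) \<Longrightarrow> f p = f q"
  shows "(\<Sum>p | p permutes {0..<a}. signof p *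
     (f p * (2 * of_nat c * of_int (y (p (2 * m)) - y (p (Suc (2 * m))))))) = (0 :: complex)"
proof (cases "c = 1")
  case False
  then show ?thesis using c_cases by simp
next
  case True
  then have a: "2 * h < a" unfolding a_def by simp
  have 1: "(\<Sum>p | p permutes {0..<a}. signof p * (f p * of_int (y (p (2 * m))))) = 0"
    using m a
    by (intro alternating_sum_zero[of "Suc (2 * m)" _ "2 * h"]
        arg_cong2[where f = "(*)"] f arg_cong[where f = of_int]) (auto simp: transpose_def)
  have 2: "(\<Sum>p | p permutes {0..<a}. signof p * (f p * of_int (y (p (Suc (2 * m)))))) = 0"
    using m a
    by (intro alternating_sum_zero[of "2 * m" _ "2 * h"]
        arg_cong2[where f = "(*)"] f arg_cong[where f = of_int]) (auto simp: transpose_def)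
  have "(\<Sum>p | p permutes {0..<a}. signof p *
     (f p * (2 * of_nat c * of_int (y (p (2 * m)) - y (p (Suc (2 * m))))))) =
     2 * of_nat c * ((\<Sum>p | p permutes {0..<a}. signof p * (f p * of_int (y (p (2 * m))))) -
     (\<Sum>p | p permutes {0..<a}. signof p * (f p * of_int (y (p (Suc (2 * m)))))))"
    by (simp add: sum_distrib_left sum_subtractf[symmetric] algebra_simps)
  then show ?thesis unfolding 1 2 by simp
qed

text \<open>
  On admissible configurations \<open>\<bar>y i - y j\<bar> < N\<close>, and after removing the linear terms one
  pair at a time only the signs of the differences remain.  They depend only on the order of the
  positions, so the right-hand side is the same for all admissible \<open>y\<close>.
\<close>

lemma cyl_sum_0_alcove:
  assumes mono: "\<And>i j. i < j \<Longrightarrow> j < a \<Longrightarrow> y i < y j"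
    and narrow: "y (a - 1) - y 0 < int N"
  shows "cyl_sum 0 y = normalizer * (\<Sum>p | p permutes {0..<a}. signof p *
     (\<Prod>j<h. - of_nat N * of_int (sgn (int (p (2 * j)) - int (p (Suc (2 * j)))))))"
proof -
  define s :: "nat \<Rightarrow> (nat \<Rightarrow> nat) \<Rightarrow> complex"
    where "s = (\<lambda>j p. - of_nat N * of_int (sgn (int (p (2 * j)) - int (p (Suc (2 * j))))))"
  define d where "d = (\<lambda>j p. y (p (2 * j)) - y (p (Suc (2 * j))))"
  \<comment> \<open>the first \<open>m\<close> pairs still carry the linear term, the remaining ones only the sign\<close>
  define H where "H = (\<lambda>m. \<Sum>p | p permutes {0..<a}. signof p *
     ((\<Prod>j<m. pair_sum (d j p)) * (\<Prod>j=m..<h. s j p)))"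
  have mono': "y i \<le> y j" if "i \<le> j" "j < a" for i j
    using mono[of i j] that by (cases "i = j") auto
  have bound: "\<bar>y i - y j\<bar> < int N" if "i < a" "j < a" for i j
  proof -
    have "i \<le> a - 1" "j \<le> a - 1" "a - 1 < a" using that by auto
    then show ?thesis
      using mono'[of 0 i] mono'[of i "a - 1"] mono'[of 0 j] mono'[of j "a - 1"] that narrow by linarith
  qed
  have sgn: "sgn (y i - y j) = sgn (int i - int j)" if "i < a" "j < a" for i j
    using mono[of i j] mono[of j i] that by (cases i j rule: linorder_cases) auto
  have pair_sum: "pair_sum (d j p) = 2 * of_nat c * of_int (d j p) + s j p"
    if "p permutes {0..<a}" "j < h" for j p
  proof -
    have "p (2 * j) < a" "p (Suc (2 * j)) < a"
      using permutes_in_image[OF that(1)] that(2) by (auto simp: a_def)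
    then show ?thesis unfolding d_def s_def by (simp add: pair_sum_eq bound sgn)
  qed
  have step: "H (Suc m) = H m" if m: "m < h" for m
  proof -
    let ?f = "\<lambda>p. (\<Prod>j<m. pair_sum (d j p)) * (\<Prod>j=Suc m..<h. s j p)"
    have dm: "d m = (\<lambda>p. y (p (2 * m)) - y (p (Suc (2 * m))))" unfolding d_def ..
    have split: "signof p * ((\<Prod>j<Suc m. pair_sum (d j p)) * (\<Prod>j=Suc m..<h. s j p)) =
        signof p * (?f p * (2 * of_nat c * of_int (d m p))) +
        signof p * ((\<Prod>j<m. pair_sum (d j p)) * (\<Prod>j=m..<h. s j p))" if "p permutes {0..<a}" for p
      unfolding prod.lessThan_Suc pair_sum[OF that m] prod.atLeast_Suc_lessThan[OF m]
      by (simp add: algebra_simps)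
    have fcong: "?f p = ?f q"
      if eq: "\<And>k. k \<notin> {2 * m, Suc (2 * m), 2 * h} \<Longrightarrow> p k = q k" for p q
    proof -
      have pq: "p (2 * j) = q (2 * j)" "p (Suc (2 * j)) = q (Suc (2 * j))" if "j < h" "j \<noteq> m" for j
        using that
        by (simp_all add: eq Suc_double_not_eq_double double_not_eq_Suc_double)
      have "pair_sum (d j p) = pair_sum (d j q)" if "j < m" for j
        using pq[of j] that m unfolding d_def by simp
      moreover have "s j p = s j q" if "Suc m \<le> j" "j < h" for j
        using pq[of j] that unfolding s_def by simp
      ultimately show ?thesis by (intro arg_cong2[where f = "(*)"] prod.cong) auto
    qed
    have "(\<Sum>p | p permutes {0..<a}. signof p * (?f p * (2 * of_nat c * of_int (d m p)))) = 0"
      unfolding dm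
    proof (rule linear_terms_cancel[OF m, of ?f y])
      fix p q :: "nat \<Rightarrow> nat"
      assume "\<And>k. k \<notin> {2 * m, Suc (2 * m), 2 * h} \<Longrightarrow> p k = q k"
      then show "?f p = ?f q" by (rule fcong)
    qed
    moreover have "H (Suc m) =
        (\<Sum>p | p permutes {0..<a}. signof p * (?f p * (2 * of_nat c * of_int (d m p)))) + H m"
      unfolding H_def sum.distrib[symmetric] by (intro sum.cong refl split) auto
    ultimately show ?thesis by (simp only: add_0_left)
  qed
  have "m \<le> h \<Longrightarrow> H m = H 0" for m
    by (induction m) (simp_all add: step)
  from this[of h] have "H h = H 0" by simp
  then show ?thesis
    unfolding cyl_sum_0_expand H_def d_def s_def
    by (simp only: atLeast0LessThan atLeastLessThan_empty_iff atLeastLessThan_empty order_refl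
        prod.empty lessThan_0 mult_1 mult_1_right)
qed

text \<open>
  The constant value is found at the packed configuration, where \<open>cyl_sum 0\<close> equals \<open>box_sum 0\<close>.
\<close>

lemma cyl_sum_init:
  assumes "\<And>i j. i < j \<Longrightarrow> j < a \<Longrightarrow> y i < y j" and "y (a - 1) - y 0 < int N"
  shows "cyl_sum 0 y = 1"
proof -
  have "N > a - 1" using h_pos by (simp add: N_def a_def)
  then have "cyl_sum 0 int = cyl_sum 0 y"
    by (intro trans[OF cyl_sum_0_alcove cyl_sum_0_alcove[OF assms, symmetric]]) auto
  then show ?thesis
    using cyl_sum_packed[of 0] box_sum_init[of "\<lambda>i. int i + 1"] by (simp add: M_def)
qed

end

section \<open>Cylindric tableaux and their seam\<close>

lemma mem_diagram: "(i, j) \<in> diagram l \<longleftrightarrow> 0 \<le> i \<and> 0 \<le> j \<and> j < int (l (nat i))"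
proof
  assume "0 \<le> i \<and> 0 \<le> j \<and> j < int (l (nat i))"
  then show "(i, j) \<in> diagram l"
    unfolding diagram_def by (intro CollectI exI[of _ "nat i"] exI[of _ "nat j"]) auto
qed (auto simp: diagram_def)

lemma partition_le: "is_partition l \<Longrightarrow> i \<le> k \<Longrightarrow> l k \<le> l i"
  unfolding is_partition_def by (blast dest: antimonoD)

lemma is_partition_upd_incr:
  assumes "is_partition l" "i = 0 \<or> l i < l (i - 1)"
  shows "is_partition (l(i := l i + 1))"
proof -
  have "finite {k. (l(i := l i + 1)) k \<noteq> 0}"
    by (rule finite_subset[of _ "insert i {k. l k \<noteq> 0}"])
      (use assms(1) in \<open>auto simp: is_partition_def\<close>)
  moreover have "antimono (l(i := l i + 1))"
    unfolding antimono_iff_le_Suc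
  proof
    fix k
    have "l (Suc k) \<le> l k" using assms(1) by (simp add: is_partition_def antimono_iff_le_Suc)
    moreover have "Suc k = i \<Longrightarrow> l i < l k" using assms(2) by force
    ultimately show "(l(i := l i + 1)) (Suc k) \<le> (l(i := l i + 1)) k"
      by (cases "Suc k = i"; cases "k = i"; simp)
  qed
  ultimately show ?thesis by (simp only: is_partition_def)
qed

lemma is_partition_upd_decr:
  assumes "is_partition l" "l (Suc i) < l i"
  shows "is_partition (l(i := l i - 1))"
proof -
  have "finite {k. (l(i := l i - 1)) k \<noteq> 0}"
    by (rule finite_subset[of _ "{k. l k \<noteq> 0}"])
      (use assms(1) in \<open>auto simp: is_partition_def\<close>)
  moreover have "antimono (l(i := l i - 1))"
    unfolding antimono_iff_le_Suc
  proof
    fix k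
    have "l (Suc k) \<le> l k" using assms(1) by (simp add: is_partition_def antimono_iff_le_Suc)
    moreover have "k = i \<Longrightarrow> l (Suc k) < l i" using assms(2) by simp
    ultimately show "(l(i := l i - 1)) (Suc k) \<le> (l(i := l i - 1)) k"
      by (cases "Suc k = i"; cases "k = i"; simp)
  qed
  ultimately show ?thesis by (simp only: is_partition_def)
qed

text \<open>
  Columns of a skew shape have no gaps.  This is what the validity of the shape of
  \<open>T \<union> (T + (a, -b))\<close> contributes to the seam condition.
\<close>

lemma skew_shape_column_convex:
  assumes "is_skew_shape S" "(i, j) \<in> S" "(k, j) \<in> S" "i \<le> t" "t \<le> k"
  shows "(t, j) \<in> S"
proof -
  from assms(1) obtain l m r c where part: "is_partition l" "is_partition m"
    and S: "S = (\<lambda>(i, j). (i + r, j + c)) ` (diagram l - diagram m)"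
    unfolding is_skew_shape_def by blast
  have mem: "(i, j) \<in> S \<longleftrightarrow> (i - r, j - c) \<in> diagram l - diagram m" for i j
    unfolding S by (auto intro!: image_eqI[where x = "(i - r, j - c)"])
  have "l (nat (k - r)) \<le> l (nat (t - r))" "m (nat (t - r)) \<le> m (nat (i - r))"
    using assms(4,5) by (auto intro!: partition_le[OF part(1)] partition_le[OF part(2)])
  then show ?thesis using assms(2-5) unfolding mem by (auto simp: mem_diagram)
qed

definition rowlen :: "filling \<Rightarrow> nat \<Rightarrow> nat" where
  "rowlen T i = card {j. (int i, j) \<in> dom T}"

lemma rowlen_diagram: "dom T = diagram l \<Longrightarrow> rowlen T = l"
proof
  fix i assume "dom T = diagram l"
  then have "{j. (int i, j) \<in> dom T} = {0..<int (l i)}" by (auto simp: mem_diagram)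
  then show "rowlen T i = l i" by (simp add: rowlen_def)
qed

text \<open>
  Cells of \<open>T\<close> and of its shifted copy meet only in columns, across the boundary between the rows
  \<open>a - 1\<close> and \<open>a\<close>.  By monotonicity along the columns it suffices to compare these two rows, that is,
  the last row of \<open>T\<close> with the first row moved left by \<open>b\<close>.  Comparing them as sets of cells also
  yields the inequality that makes the union a skew shape.
\<close>

lemma cylindric_iff:
  assumes l: "is_partition l" and dom: "dom T = diagram l" and "a > 0"
    and pos: "0 \<notin> ran T"
    and rows: "\<And>i j j' x y. T (i, j) = Some x \<Longrightarrow> T (i, j') = Some y \<Longrightarrow> j < j' \<Longrightarrow> x < y"
    and cols: "\<And>i i' j x y. T (i, j) = Some x \<Longrightarrow> T (i', j) = Some y \<Longrightarrow> i < i' \<Longrightarrow> x < y"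
  shows "cylindric a b T \<longleftrightarrow> (\<forall>i\<ge>a. l i = 0) \<and>
    (\<forall>j y. 0 \<le> j \<longrightarrow> T (0, j + int b) = Some y \<longrightarrow> (\<exists>x<y. T (int a - 1, j) = Some x))"
    (is "_ \<longleftrightarrow> ?R \<and> ?S")
proof -
  define U where "U = T ++ shift a b T"
  have T_dom: "T (i, j) = Some x \<Longrightarrow> 0 \<le> i \<and> 0 \<le> j \<and> j < int (l (nat i))" for i j x
    using dom mem_diagram[of i j l] by (metis domI)
  have dom_T: "0 \<le> i \<Longrightarrow> 0 \<le> j \<Longrightarrow> j < int (l (nat i)) \<Longrightarrow> \<exists>x. T (i, j) = Some x" for i j
    using dom mem_diagram[of i j l] by (metis domD)
  have U: "U (i, j) = (case T (i - int a, j + int b) of None \<Rightarrow> T (i, j) | Some x \<Rightarrow> Some x)" for i j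
    by (simp add: U_def map_add_def shift_def)
  have U_dom: "(i, j) \<in> dom U \<longleftrightarrow> (i, j) \<in> diagram l \<or> (i - int a, j + int b) \<in> diagram l" for i j
    unfolding dom[symmetric] by (auto simp: U dom_def split: option.splits)
  have row_bound: "(\<forall>(i, j)\<in>dom T. i < int a) \<longleftrightarrow> ?R"
  proof
    assume *: "\<forall>(i, j)\<in>dom T. i < int a"
    show ?R
    proof (intro allI impI, rule ccontr)
      fix i assume "a \<le> i" "l i \<noteq> 0"
      then have "(int i, 0) \<in> dom T" unfolding dom by (simp add: mem_diagram)
      from bspec[OF * this] \<open>a \<le> i\<close> show False by simp
    qed
  next
    assume R: ?R
    show "\<forall>(i, j)\<in>dom T. i < int a"
    proof (clarify, rule ccontr)
      fix i j x assume "T (i, j) = Some x" "\<not> i < int a"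
      then show False using T_dom[of i j x] R[rule_format, of "nat i"] by auto
    qed
  qed
  show ?thesis
  proof
    assume cyl: "cylindric a b T"
    then have R: ?R and ssyt: "is_skew_ssyt U"
      unfolding cylindric_def row_bound U_def by auto
    have ?S
    proof (intro allI impI)
      fix j y assume j: "0 \<le> j" and y: "T (0, j + int b) = Some y"
      have "(int a, j) \<in> dom U" "U (int a, j) = Some y" using y by (auto simp: U)
      moreover have "(0, j) \<in> dom U"
        using T_dom[OF y] j by (simp add: U_dom mem_diagram)
      ultimately have "(int a - 1, j) \<in> dom U"
        using ssyt \<open>a > 0\<close> skew_shape_column_convex[of "dom U" 0 j "int a" "int a - 1"]
        by (simp add: is_skew_ssyt_def)
      then obtain x where x: "U (int a - 1, j) = Some x" by auto
      have "T (int a - 1 - int a, j + int b) = None"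
        using T_dom[of "int a - 1 - int a" "j + int b"] by (cases "T (int a - 1 - int a, j + int b)") auto
      then have "T (int a - 1, j) = Some x" using x by (simp add: U)
      moreover have "x < y"
      proof -
        have "\<forall>i i' j x y. U (i, j) = Some x \<and> U (i', j) = Some y \<and> i < i' \<longrightarrow> x < y"
          using ssyt unfolding is_skew_ssyt_def by blast
        moreover have "int a - 1 < int a" by simp
        ultimately show ?thesis using x \<open>U (int a, j) = Some y\<close> by blast
      qed
      ultimately show "\<exists>x<y. T (int a - 1, j) = Some x" by blast
    qed
    with R show "?R \<and> ?S" ..
  next
    assume "?R \<and> ?S"
    then have R: ?R and S: ?S by auto
    have U_top: "U (i, j) = T (i, j)" if "i < int a" for i j
      using T_dom[of "i - int a" "j + int b"] that
      by (auto simp: U split: option.splits)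
    have U_bot: "U (i, j) = T (i - int a, j + int b)" if "int a \<le> i" for i j
    proof -
      have "T (i, j) = None"
        using T_dom[of i j] R[rule_format, of "nat i"] that by (cases "T (i, j)") auto
      then show ?thesis by (auto simp: U split: option.splits)
    qed
    have shape: "is_skew_shape (dom U)"
    proof -
      \<comment> \<open>moved to the right by \<open>b\<close>, the union is the part of \<open>?L\<close> outside the rectangle \<open>?M\<close>\<close>
      let ?L = "\<lambda>i. if i < a then l i + b else l (i - a)"
      let ?M = "\<lambda>i. if i < a then b else 0"
      have seam: "l 0 \<le> l (a - 1) + b"
      proof (rule ccontr)
        assume "\<not> ?thesis"
        then obtain y where "T (0, int (l (a - 1)) + int b) = Some y"
          using dom_T[of 0 "int (l (a - 1)) + int b"] by auto
        then obtain x where "T (int a - 1, int (l (a - 1))) = Some x"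
          using S[rule_format, of "int (l (a - 1))"] by auto
        moreover have "nat (int a - 1) = a - 1" using \<open>a > 0\<close> by simp
        ultimately show False using T_dom[of "int a - 1" "int (l (a - 1))" x] by simp
      qed
      have "antimono ?L"
        unfolding antimono_iff_le_Suc
      proof
        fix i
        have "l (Suc i) \<le> l i" "l (Suc i - a) \<le> l (i - a)"
          by (auto intro!: partition_le[OF l])
        moreover have "Suc i = a \<Longrightarrow> l 0 \<le> l i + b" using seam by auto
        ultimately show "?L (Suc i) \<le> ?L i" by (cases "Suc i = a") auto
      qed
      moreover have "{i. ?L i \<noteq> 0} \<subseteq> {..<2 * a}"
      proof (rule subsetI, rule ccontr)
        fix i assume i: "i \<in> {i. ?L i \<noteq> 0}" "i \<notin> {..<2 * a}"
        then have "a \<le> i - a" "\<not> i < a" by auto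
        then show False using R i(1) by simp
      qed
      then have "finite {i. ?L i \<noteq> 0}" by (rule finite_subset) simp
      ultimately have "is_partition ?L" by (simp add: is_partition_def)
      moreover have "is_partition ?M"
        unfolding is_partition_def antimono_iff_le_Suc by auto
      moreover have "diagram ?M \<subseteq> diagram ?L" by (auto simp: mem_diagram split: if_splits)
      moreover have "dom U = (\<lambda>(i, j). (i + 0, j + (- int b))) ` (diagram ?L - diagram ?M)"
      proof -
        have mem: "(i, j) \<in> dom U \<longleftrightarrow> (i, j + int b) \<in> diagram ?L - diagram ?M" for i j
        proof -
          have "nat (i - int a) = nat i - a" by simp
          then show ?thesis
            using R by (auto simp: U_dom mem_diagram split: if_splits)
        qed
        show ?thesis
        proof (intro Set.set_eqI iffI)
          fix p assume "p \<in> dom U"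
          then obtain i j where p: "p = (i, j)" "(i, j + int b) \<in> diagram ?L - diagram ?M"
            using mem by (cases p) auto
          show "p \<in> (\<lambda>(i, j). (i + 0, j + (- int b))) ` (diagram ?L - diagram ?M)"
            by (rule image_eqI[OF _ p(2)]) (simp add: p(1))
        next
          fix p assume "p \<in> (\<lambda>(i, j). (i + 0, j + (- int b))) ` (diagram ?L - diagram ?M)"
          then obtain i j where "p = (i, j - int b)" "(i, j) \<in> diagram ?L - diagram ?M" by auto
          then show "p \<in> dom U" using mem[of i "j - int b"] by simp
        qed
      qed
      ultimately show ?thesis unfolding is_skew_shape_def by blast
    qed
    have "0 \<notin> ran U"
    proof
      assume "0 \<in> ran U"
      then obtain i j where "U (i, j) = Some 0" by (auto simp: ran_def)
      then have "0 \<in> ran T" by (auto simp: U ran_def split: option.splits)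
      with pos show False ..
    qed
    moreover have "x \<le> y" if "U (i, j) = Some x" "U (i, j') = Some y" "j < j'" for i j j' x y
      using that rows[of i j x j' y] rows[of "i - int a" "j + int b" x "j' + int b" y]
      by (cases "i < int a") (auto simp: U_top U_bot)
    moreover have "x < y" if u: "U (i, j) = Some x" "U (i', j) = Some y" "i < i'" for i i' j x y
    proof -
      consider "i' < int a" | "int a \<le> i" | "i < int a" "int a \<le> i'" by linarith
      then show ?thesis
      proof cases
        case 1
        then show ?thesis using u cols[of i j x i' y] by (auto simp: U_top)
      next
        case 2
        then show ?thesis using u cols[of "i - int a" "j + int b" x "i' - int a" y] by (auto simp: U_bot)
      next
        case 3
        have Ti: "T (i, j) = Some x" and Ti': "T (i' - int a, j + int b) = Some y"
          using u 3 by (auto simp: U_top U_bot)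
        have "l (nat (i' - int a)) \<le> l 0" by (rule partition_le[OF l]) simp
        then obtain y0 where y0: "T (0, j + int b) = Some y0"
          using dom_T[of 0 "j + int b"] T_dom[OF Ti] T_dom[OF Ti'] by auto
        then obtain x1 where x1: "T (int a - 1, j) = Some x1" "x1 < y0"
          using S T_dom[OF Ti] by blast
        have "x \<le> x1" using cols[OF Ti x1(1)] Ti x1(1) 3 by (cases "i = int a - 1") auto
        moreover have "y0 \<le> y" using cols[OF y0 Ti'] y0 Ti' 3 by (cases "i' = int a") auto
        ultimately show ?thesis using x1(2) by simp
      qed
    qed
    ultimately have "is_skew_ssyt U" unfolding is_skew_ssyt_def using shape by blast
    then show "cylindric a b T" using R unfolding cylindric_def row_bound U_def by simp
  qed
qed

section \<open>Adding and removing the largest entry\<close>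

definition valid_shape :: "nat \<Rightarrow> nat \<Rightarrow> (nat \<Rightarrow> nat) \<Rightarrow> bool" where
  "valid_shape a b l \<longleftrightarrow> is_partition l \<and> (\<forall>i\<ge>a. l i = 0) \<and> l 0 \<le> l (a - 1) + b"

text \<open>
  Cylindric standard tableaux of shape \<open>l\<close> with the geometric condition replaced by the seam condition,
  which can be checked entry by entry.
\<close>

definition cyl_syt :: "nat \<Rightarrow> nat \<Rightarrow> nat \<Rightarrow> (nat \<Rightarrow> nat) \<Rightarrow> filling \<Rightarrow> bool" where
  "cyl_syt n a b l T \<longleftrightarrow> is_partition l \<and> dom T = diagram l \<and> (\<forall>i\<ge>a. l i = 0) \<and>
     bij_betw (\<lambda>c. the (T c)) (dom T) {1..n} \<and>
     (\<forall>i j j' x y. T (i, j) = Some x \<and> T (i, j') = Some y \<and> j < j' \<longrightarrow> x < y) \<and>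
     (\<forall>i i' j x y. T (i, j) = Some x \<and> T (i', j) = Some y \<and> i < i' \<longrightarrow> x < y) \<and>
     (\<forall>j y. 0 \<le> j \<longrightarrow> T (0, j + int b) = Some y \<longrightarrow> (\<exists>x<y. T (int a - 1, j) = Some x))"

lemma cyl_syt_range:
  assumes "cyl_syt n a b l T" "T c = Some x"
  shows "1 \<le> x \<and> x \<le> n"
proof -
  have "bij_betw (\<lambda>c. the (T c)) (dom T) {1..n}"
    using assms(1) unfolding cyl_syt_def by blast
  from bspec[OF bij_betwE[OF this] domI[of T, OF assms(2)]] show ?thesis using assms by simp
qed

lemma CSYT_iff_cyl_syt:
  assumes "a > 0"
  shows "T \<in> CSYT n a b \<longleftrightarrow> cyl_syt n a b (rowlen T) T"
proof -
  have cyl: "cylindric a b T \<longleftrightarrow> (\<forall>i\<ge>a. l i = 0) \<and>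
      (\<forall>j y. 0 \<le> j \<longrightarrow> T (0, j + int b) = Some y \<longrightarrow> (\<exists>x<y. T (int a - 1, j) = Some x))"
    if "T \<in> SYT n" "is_partition l" "dom T = diagram l" for l
  proof (rule cylindric_iff[OF that(2,3) assms])
    show "0 \<notin> ran T"
    proof
      assume "0 \<in> ran T"
      then obtain c where c: "T c = Some 0" by (auto simp: ran_def)
      have "bij_betw (\<lambda>c. the (T c)) (dom T) {1..n}" 
        using that(1) unfolding SYT_def by blast
      from bspec[OF bij_betwE[OF this] domI[of T, OF c]] show False using c by simp
    qed
  qed (use that(1) in \<open>unfold SYT_def, blast\<close>)+
  show ?thesis
  proof
    assume "T \<in> CSYT n a b"
    then have T: "T \<in> SYT n" "cylindric a b T" by (auto simp: CSYT_def)
    then obtain l where l: "is_partition l" "dom T = diagram l" by (auto simp: SYT_def)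
    show "cyl_syt n a b (rowlen T) T"
      using T(1) l T(2)[unfolded cyl[OF T(1) l]]
      unfolding cyl_syt_def SYT_def rowlen_diagram[OF l(2)] by blast
  next
    assume T: "cyl_syt n a b (rowlen T) T"
    then have S: "T \<in> SYT n" unfolding cyl_syt_def SYT_def by blast
    moreover have "cylindric a b T"
      using T cyl[OF S] unfolding cyl_syt_def by blast
    ultimately show "T \<in> CSYT n a b" by (simp add: CSYT_def)
  qed
qed

lemma cyl_syt_dom: "cyl_syt n a b l T \<Longrightarrow> (i, j) \<in> dom T \<longleftrightarrow> 0 \<le> i \<and> 0 \<le> j \<and> j < int (l (nat i))"
  by (simp add: cyl_syt_def mem_diagram)

lemma cyl_syt_someD:
  "cyl_syt n a b l T \<Longrightarrow> T (i, j) = Some x \<Longrightarrow> 0 \<le> i \<and> 0 \<le> j \<and> j < int (l (nat i))"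
  using cyl_syt_dom domI by metis

lemma cyl_syt_someI:
  assumes "cyl_syt n a b l T" "0 \<le> i" "0 \<le> j" "j < int (l (nat i))"
  obtains x where "T (i, j) = Some x"
  using assms cyl_syt_dom[of n a b l T i j] by auto

lemma cyl_syt_rows:
  "cyl_syt n a b l T \<Longrightarrow> T (i, j) = Some x \<Longrightarrow> T (i, j') = Some y \<Longrightarrow> j < j' \<Longrightarrow> x < y"
  unfolding cyl_syt_def by blast

lemma cyl_syt_cols:
  "cyl_syt n a b l T \<Longrightarrow> T (i, j) = Some x \<Longrightarrow> T (i', j) = Some y \<Longrightarrow> i < i' \<Longrightarrow> x < y"
  unfolding cyl_syt_def by blast

lemma cyl_syt_seam:
  "cyl_syt n a b l T \<Longrightarrow> 0 \<le> j \<Longrightarrow> T (0, j + int b) = Some y \<Longrightarrow> \<exists>x<y. T (int a - 1, j) = Some x"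
  unfolding cyl_syt_def by blast

lemma cyl_syt_valid:
  assumes T: "cyl_syt n a b l T" and "a > 0"
  shows "valid_shape a b l"
proof -
  have "l 0 \<le> l (a - 1) + b"
  proof (rule ccontr)
    assume "\<not> ?thesis"
    then obtain y where "T (0, int (l (a - 1)) + int b) = Some y"
      using cyl_syt_someI[OF T, of 0 "int (l (a - 1)) + int b"] by auto
    then obtain x where "T (int a - 1, int (l (a - 1))) = Some x"
      using cyl_syt_seam[OF T, of "int (l (a - 1))"] by auto
    moreover have "nat (int a - 1) = a - 1" using \<open>a > 0\<close> by simp
    ultimately show False using cyl_syt_someD[OF T, of "int a - 1" "int (l (a - 1))" x] by simp
  qed
  then show ?thesis using T unfolding cyl_syt_def valid_shape_def by blast
qed

lemma diagram_incr: "diagram (l(i := l i + 1)) = insert (int i, int (l i)) (diagram l)"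
proof (rule Set.set_eqI, clarify)
  fix r j :: int
  show "(r, j) \<in> diagram (l(i := l i + 1)) \<longleftrightarrow> (r, j) \<in> insert (int i, int (l i)) (diagram l)"
    by (cases "0 \<le> r"; cases "nat r = i") (auto simp: mem_diagram)
qed

text \<open>
  The new entry is larger than all others, so the inequalities can fail only if a cell to compare with
  is missing; the condition on the enlarged shape excludes this.
\<close>

lemma cyl_syt_add_entry:
  assumes T: "cyl_syt n a b l T" and "a > 1"
    and valid: "valid_shape a b (l(i := l i + 1))"
  shows "cyl_syt (Suc n) a b (l(i := l i + 1)) (T((int i, int (l i)) \<mapsto> Suc n))"
proof -
  let ?c = "(int i, int (l i))"
  let ?T = "T(?c \<mapsto> Suc n)"
  have fresh: "?c \<notin> diagram l" by (simp add: mem_diagram)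
  have dom: "dom T = diagram l" and part: "is_partition l" using T by (auto simp: cyl_syt_def)
  have new: "?T p = Some x \<longleftrightarrow> (if p = ?c then x = Suc n else T p = Some x)" for p x by auto
  have small: "T p = Some x \<Longrightarrow> x \<le> n" for p x using cyl_syt_range[OF T] by blast
  have ext: "bij_betw (\<lambda>c. the (?T c)) (diagram l \<union> {?c}) ({1..n} \<union> {the (?T ?c)})"
  proof (rule notIn_Un_bij_betw)
    have "bij_betw (\<lambda>c. the (T c)) (diagram l) {1..n}" using T dom by (simp add: cyl_syt_def)
    then show "bij_betw (\<lambda>c. the (?T c)) (diagram l) {1..n}"
      by (rule bij_betw_cong[THEN iffD1, rotated]) (use fresh in auto)
  qed (use fresh in auto)
  have vals: "{1..n} \<union> {the (?T ?c)} = {1..Suc n}" by auto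
  have dom': "dom ?T = diagram (l(i := l i + 1))"
    unfolding diagram_incr dom[symmetric] by auto
  have "bij_betw (\<lambda>c. the (?T c)) (dom ?T) {1..Suc n}"
    using ext unfolding vals dom' diagram_incr by (simp only: Un_insert_right Un_empty_right)
  moreover have "x < y" if "?T (r, j) = Some x" "?T (r, j') = Some y" "j < j'" for r j j' x y
    using that small[of "(r, j)" x] cyl_syt_rows[OF T, of r j x j' y] cyl_syt_someD[OF T, of r j' y]
    unfolding new by (auto split: if_splits)
  moreover have "x < y" if "?T (r, j) = Some x" "?T (r', j) = Some y" "r < r'" for r r' j x y
  proof -
    have "l (nat r') \<le> l (nat r)" using that(3) by (intro partition_le[OF part]) simp
    then show ?thesis
      using that small[of "(r, j)" x] cyl_syt_cols[OF T, of r j x r' y] cyl_syt_someD[OF T, of r' j y]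
      unfolding new by (auto split: if_splits)
  qed
  moreover have "\<exists>x<y. ?T (int a - 1, j) = Some x"
    if j: "0 \<le> j" and y: "?T (0, j + int b) = Some y" for j y
  proof (cases "(0, j + int b) = ?c")
    case True
    then have i: "i = 0" "j + int b = int (l 0)" by auto
    have last: "nat (int a - 1) = a - 1" "int a - 1 \<noteq> 0" using \<open>a > 1\<close> by auto
    have "l 0 + 1 \<le> l (a - 1) + b" using valid i \<open>a > 1\<close> by (simp add: valid_shape_def)
    then have "j < int (l (nat (int a - 1)))" using i(2) last(1) by simp
    then obtain x where x: "T (int a - 1, j) = Some x"
      using cyl_syt_someI[OF T, of "int a - 1" j] j \<open>a > 1\<close> by auto
    then show ?thesis using small[OF x] y True i(1) last(2) by auto
  next
    case False
    then have "T (0, j + int b) = Some y" using y by auto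
    then obtain x where x: "x < y" "T (int a - 1, j) = Some x"
      using cyl_syt_seam[OF T j] by blast
    then have "(int a - 1, j) \<noteq> ?c" using fresh dom by (metis domI)
    then show ?thesis using x by auto
  qed
  ultimately show ?thesis
    using valid dom' unfolding cyl_syt_def valid_shape_def by blast
qed

text \<open>
  The largest entry occupies a corner, since the cells to its right and below it would have to contain
  larger entries.
\<close>

lemma cyl_syt_remove_entry:
  assumes T: "cyl_syt (Suc n) a b l T"
  obtains i l' T' where "cyl_syt n a b l' T'" "i < a" "l = l'(i := l' i + 1)"
    "T = T'((int i, int (l' i)) \<mapsto> Suc n)"
proof -
  have dom: "dom T = diagram l" and part: "is_partition l"
    and bij: "bij_betw (\<lambda>c. the (T c)) (dom T) {1..Suc n}"
    and bound: "\<forall>i\<ge>a. l i = 0"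
    using T by (auto simp: cyl_syt_def)
  have "Suc n \<in> (\<lambda>c. the (T c)) ` dom T" using bij by (simp add: bij_betw_def)
  then obtain r j where c: "T (r, j) = Some (Suc n)" by force
  define i where "i = nat r"
  have rj: "0 \<le> r" "0 \<le> j" "j < int (l i)" using cyl_syt_someD[OF T c] by (auto simp: i_def)
  have top: "T p = Some x \<Longrightarrow> x \<le> Suc n" for p x using cyl_syt_range[OF T] by blast
  have "\<not> j + 1 < int (l i)"
  proof
    assume "j + 1 < int (l i)"
    then obtain x where x: "T (r, j + 1) = Some x"
      using cyl_syt_someI[OF T, of r "j + 1"] rj by (auto simp: i_def)
    show False using cyl_syt_rows[OF T c x] top[OF x] by simp
  qed
  then have j: "j = int (l i - 1)" "l i > 0" using rj by auto
  have "\<not> j < int (l (Suc i))"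
  proof
    assume "j < int (l (Suc i))"
    moreover have "nat (r + 1) = Suc i" using rj by (simp add: i_def)
    ultimately obtain x where x: "T (r + 1, j) = Some x"
      using cyl_syt_someI[OF T, of "r + 1" j] rj by auto
    show False using cyl_syt_cols[OF T c x] top[OF x] by simp
  qed
  then have corner: "l (Suc i) < l i" using j by linarith
  define l' where "l' = l(i := l i - 1)"
  have l: "l = l'(i := l' i + 1)" using j(2) by (auto simp: l'_def)
  have rjc: "(r, j) = (int i, int (l' i))" using rj(1) j(1) by (simp add: i_def l'_def)
  define T' where "T' = T((r, j) := None)"
  have fresh: "(int i, int (l' i)) \<notin> diagram l'" by (simp add: mem_diagram)
  have sub: "T' p = Some x \<longleftrightarrow> p \<noteq> (r, j) \<and> T p = Some x" for p x by (auto simp: T'_def)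
  have dom': "dom T' = diagram l'"
    unfolding T'_def dom_fun_upd
    using fresh by (simp add: dom rjc, subst (1) l, subst diagram_incr) auto
  have "bij_betw (\<lambda>c. the (T' c)) (dom T') {1..n}"
  proof -
    have inj: "inj_on (\<lambda>c. the (T c)) (dom T)" and im: "(\<lambda>c. the (T c)) ` dom T = {1..Suc n}"
      using bij by (auto simp: bij_betw_def)
    have D: "dom T' = dom T - {(r, j)}" by (auto simp: T'_def)
    have "(\<lambda>c. the (T c)) ` (dom T - {(r, j)}) =
        (\<lambda>c. the (T c)) ` dom T - (\<lambda>c. the (T c)) ` {(r, j)}"
      by (rule inj_on_image_set_diff[OF inj]) (use c in auto)
    also have "\<dots> = {1..n}" unfolding im using c by auto
    finally have "bij_betw (\<lambda>c. the (T c)) (dom T - {(r, j)}) {1..n}"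
      using inj by (auto simp: bij_betw_def intro: inj_on_subset)
    then show ?thesis
      unfolding D by (rule bij_betw_cong[THEN iffD1, rotated]) (auto simp: T'_def)
  qed
  moreover have "x < y" if "T' (r, j) = Some x" "T' (r, j') = Some y" "j < j'" for r j j' x y
    using that cyl_syt_rows[OF T, of r j x j' y] by (simp add: sub)
  moreover have "x < y" if "T' (r, j) = Some x" "T' (r', j) = Some y" "r < r'" for r r' j x y
    using that cyl_syt_cols[OF T, of r j x r' y] by (simp add: sub)
  moreover have "\<exists>x<y. T' (int a - 1, k) = Some x"
    if k: "0 \<le> k" and y: "T' (0, k + int b) = Some y" for k y
  proof -
    have y': "T (0, k + int b) = Some y" using y by (simp add: sub)
    then obtain x where x: "x < y" "T (int a - 1, k) = Some x"
      using cyl_syt_seam[OF T k] by blast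
    then have "(int a - 1, k) \<noteq> (r, j)" using c top[OF y'] by auto
    then show ?thesis using x by (auto simp: sub)
  qed
  moreover have "is_partition l'" unfolding l'_def by (rule is_partition_upd_decr[OF part corner])
  moreover have "\<forall>i\<ge>a. l' i = 0" using bound by (simp add: l'_def)
  ultimately have "cyl_syt n a b l' T'" using dom' unfolding cyl_syt_def by blast
  moreover have "i < a" using bound j(2) by (metis not_less less_irrefl)
  moreover have "T = T'((int i, int (l' i)) \<mapsto> Suc n)"
    using c unfolding rjc[symmetric] T'_def by auto
  ultimately show ?thesis using that l by blast
qed

definition moves :: "nat \<Rightarrow> nat \<Rightarrow> filling \<Rightarrow> nat set" where
  "moves a b T = {i. i < a \<and> valid_shape a b ((rowlen T)(i := rowlen T i + 1))}"

definition add_entry :: "nat \<Rightarrow> filling \<Rightarrow> nat \<Rightarrow> filling" where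
  "add_entry m T i = T((int i, int (rowlen T i)) \<mapsto> m)"

lemma cyl_syt_rowlen: "cyl_syt n a b l T \<Longrightarrow> rowlen T = l"
  by (simp add: cyl_syt_def rowlen_diagram)

lemma
  assumes "T \<in> CSYT n a b" "a > 1" "i \<in> moves a b T"
  shows add_entry_CSYT: "add_entry (Suc n) T i \<in> CSYT (Suc n) a b"
    and rowlen_add_entry: "rowlen (add_entry (Suc n) T i) = (rowlen T)(i := rowlen T i + 1)"
proof -
  have "cyl_syt n a b (rowlen T) T" using assms by (simp add: CSYT_iff_cyl_syt)
  then have *: "cyl_syt (Suc n) a b ((rowlen T)(i := rowlen T i + 1)) (add_entry (Suc n) T i)"
    unfolding add_entry_def using assms by (intro cyl_syt_add_entry) (auto simp: moves_def)
  then show r: "rowlen (add_entry (Suc n) T i) = (rowlen T)(i := rowlen T i + 1)"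
    by (rule cyl_syt_rowlen)
  show "add_entry (Suc n) T i \<in> CSYT (Suc n) a b"
    using * assms(2) unfolding r[symmetric] by (simp add: CSYT_iff_cyl_syt)
qed

lemma bij_add_entry:
  assumes "a > 1"
  shows "bij_betw (\<lambda>(T, i). add_entry (Suc n) T i) (SIGMA T:CSYT n a b. moves a b T) (CSYT (Suc n) a b)"
proof (rule bij_betw_imageI)
  show "inj_on (\<lambda>(T, i). add_entry (Suc n) T i) (SIGMA T:CSYT n a b. moves a b T)"
  proof (rule inj_onI, clarify)
    fix T1 i1 T2 i2
    assume T: "T1 \<in> CSYT n a b" "T2 \<in> CSYT n a b"
      and eq: "add_entry (Suc n) T1 i1 = add_entry (Suc n) T2 i2"
    let ?c1 = "(int i1, int (rowlen T1 i1))" and ?c2 = "(int i2, int (rowlen T2 i2))"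
    have cyl: "cyl_syt n a b (rowlen T1) T1" "cyl_syt n a b (rowlen T2) T2"
      using T assms by (auto simp: CSYT_iff_cyl_syt)
    have fresh: "T1 ?c1 = None" "T2 ?c2 = None"
      using cyl_syt_dom[OF cyl(1), of "int i1" "int (rowlen T1 i1)"]
        cyl_syt_dom[OF cyl(2), of "int i2" "int (rowlen T2 i2)"] by auto
    have "add_entry (Suc n) T1 i1 ?c2 = Some (Suc n)"
      unfolding eq by (simp add: add_entry_def)
    then have c: "?c1 = ?c2"
      using cyl_syt_range[OF cyl(1), of ?c2 "Suc n"] by (auto simp: add_entry_def split: if_splits)
    have "T1 = (add_entry (Suc n) T1 i1)(?c1 := None)"
      using fresh by (auto simp: add_entry_def)
    also have "\<dots> = (add_entry (Suc n) T2 i2)(?c2 := None)" unfolding eq c ..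
    also have "\<dots> = T2" using fresh by (auto simp: add_entry_def)
    finally show "T1 = T2 \<and> i1 = i2" using c by simp
  qed
  show "(\<lambda>(T, i). add_entry (Suc n) T i) ` (SIGMA T:CSYT n a b. moves a b T) = CSYT (Suc n) a b"
  proof (intro equalityI subsetI)
    fix T assume "T \<in> (\<lambda>(T, i). add_entry (Suc n) T i) ` (SIGMA T:CSYT n a b. moves a b T)"
    then show "T \<in> CSYT (Suc n) a b" using add_entry_CSYT assms by auto
  next
    fix T assume "T \<in> CSYT (Suc n) a b"
    then have T: "cyl_syt (Suc n) a b (rowlen T) T" using assms by (simp add: CSYT_iff_cyl_syt)
    then obtain i l' T' where *: "cyl_syt n a b l' T'" "i < a" "rowlen T = l'(i := l' i + 1)"
      "T = T'((int i, int (l' i)) \<mapsto> Suc n)" by (rule cyl_syt_remove_entry)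
    have l': "rowlen T' = l'" by (rule cyl_syt_rowlen[OF *(1)])
    have "valid_shape a b (l'(i := l' i + 1))"
      using cyl_syt_valid[OF T] assms *(3) by simp
    then have "i \<in> moves a b T'" using *(2) by (simp add: moves_def l')
    moreover have "T' \<in> CSYT n a b" using *(1) assms by (simp add: CSYT_iff_cyl_syt l')
    moreover have "T = add_entry (Suc n) T' i" using *(4) by (simp add: add_entry_def l')
    ultimately show "T \<in> (\<lambda>(T, i). add_entry (Suc n) T i) ` (SIGMA T:CSYT n a b. moves a b T)"
      by auto
  qed
qed

lemma CSYT_0:
  assumes "a > 0"
  shows "CSYT 0 a b = {Map.empty}"
proof -
  have "T = Map.empty" if "T \<in> CSYT 0 a b" for T
  proof -
    have "bij_betw (\<lambda>c. the (T c)) (dom T) {}"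
      using that assms unfolding CSYT_def SYT_def by simp
    then show ?thesis by (simp add: bij_betw_def)
  qed
  moreover have "diagram (\<lambda>_. 0) = {}" by (auto simp: diagram_def)
  then have "cyl_syt 0 a b (\<lambda>_. 0) Map.empty"
    unfolding cyl_syt_def by (simp add: is_partition_def bij_betw_def antimono_def)
  then have "Map.empty \<in> CSYT 0 a b"
    using cyl_syt_rowlen assms by (simp add: CSYT_iff_cyl_syt)
  ultimately show ?thesis by blast
qed

lemma finite_CSYT:
  assumes "a > 1"
  shows "finite (CSYT n a b)"
proof (induction n)
  case 0
  then show ?case using CSYT_0[of a b] assms by simp
next
  case (Suc n)
  have "finite (moves a b T)" for T
    by (rule finite_subset[of _ "{..<a}"]) (auto simp: moves_def)
  with Suc have "finite (SIGMA T:CSYT n a b. moves a b T)" by simp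
  then show ?case using bij_betw_finite[OF bij_add_entry[OF assms]] by blast
qed

lemma CSYT_valid: "T \<in> CSYT n a b \<Longrightarrow> a > 0 \<Longrightarrow> valid_shape a b (rowlen T)"
  by (simp add: CSYT_iff_cyl_syt cyl_syt_valid)

section \<open>Counting cylindric tableaux\<close>

context cylinder
begin

definition pos :: "(nat \<Rightarrow> nat) \<Rightarrow> nat \<Rightarrow> int" where
  "pos l i = int i - int (l i)"

lemma pos_upd: "pos (l(i := l i + 1)) = (pos l)(i := pos l i - 1)"
  by (rule ext) (simp add: pos_def)

lemma a_gt_1: "a > 1" using h_pos by (simp add: a_def)

text \<open>
  An enlarged shape is inadmissible in two ways: two neighbouring rows violate the partition condition,
  or the first row outgrows the last one by more than \<open>b\<close>.  In both cases two particles collide on the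
  circle, in the second case after going around it.
\<close>

lemma cyl_sum_invalid:
  assumes l: "valid_shape a b l" and i: "i < a" and bad: "\<not> valid_shape a b (l(i := l i + 1))"
  shows "cyl_sum k (pos (l(i := l i + 1))) = 0"
proof -
  have bound: "\<And>k. a \<le> k \<Longrightarrow> l k = 0" and seam: "l 0 \<le> l (a - 1) + b" and part: "is_partition l"
    using l unfolding valid_shape_def by blast+
  show ?thesis
  proof (cases "i = 0 \<or> l i < l (i - 1)")
    case False
    have "l i \<le> l (i - 1)" by (rule partition_le[OF part]) simp
    with False obtain m where m: "i = Suc m" "l (Suc m) = l m" by (cases i) auto
    then show ?thesis using i by (intro cyl_sum_equal[of i m]) (simp_all add: pos_def)
  next
    case True
    let ?l = "l(i := l i + 1)"
    have "is_partition ?l" by (rule is_partition_upd_incr[OF part True])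
    moreover have "\<forall>k\<ge>a. ?l k = 0" using bound i by simp
    ultimately have over: "?l (a - 1) + b < ?l 0"
      using bad unfolding valid_shape_def not_le[symmetric] by blast
    have zero: "i = 0"
    proof (rule ccontr)
      assume "i \<noteq> 0"
      then have "?l 0 = l 0" "l (a - 1) \<le> ?l (a - 1)" by simp_all
      then show False using over seam by linarith
    qed
    have "a - 1 \<noteq> 0" using a_gt_1 by simp
    then have "l 0 = l (a - 1) + b" using over seam by (simp add: zero)
    then have "pos ?l (a - 1) = pos ?l 0 + int N"
    proof -
      have "int (a - 1) = int a - 1" using a_gt_1 by simp
      then show ?thesis using \<open>a - 1 \<noteq> 0\<close> \<open>l 0 = l (a - 1) + b\<close>
        unfolding pos_def zero N_def by simp
    qed
    then show ?thesis using a_gt_1 by (intro cyl_sum_wrap[of "a - 1" 0]) simp_all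
  qed
qed

text \<open>
  Transfer of one step from the tableau to the function: removing the largest entry, the moves that
  are not allowed may be added to the sum because \<open>cyl_sum\<close> vanishes there.
\<close>

lemma sum_CSYT_step:
  "(\<Sum>T\<in>CSYT (Suc n) a b. cyl_sum k (pos (rowlen T))) = (\<Sum>T\<in>CSYT n a b. cyl_sum (Suc k) (pos (rowlen T)))"
proof -
  have fin: "finite (moves a b T)" for T
    by (rule finite_subset[of _ "{..<a}"]) (auto simp: moves_def)
  have "(\<Sum>T\<in>CSYT (Suc n) a b. cyl_sum k (pos (rowlen T))) =
      (\<Sum>(T, i)\<in>(SIGMA T:CSYT n a b. moves a b T). cyl_sum k (pos (rowlen (add_entry (Suc n) T i))))"
    by (subst sum.reindex_bij_betw[OF bij_add_entry[OF a_gt_1], symmetric])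
      (simp add: case_prod_unfold)
  also have "\<dots> = (\<Sum>T\<in>CSYT n a b. \<Sum>i\<in>moves a b T. cyl_sum k (pos (rowlen (add_entry (Suc n) T i))))"
    by (rule sum.Sigma[symmetric]) (use fin finite_CSYT[OF a_gt_1] in auto)
  also have "\<dots> = (\<Sum>T\<in>CSYT n a b. cyl_sum (Suc k) (pos (rowlen T)))"
  proof (rule sum.cong[OF refl])
    fix T assume T: "T \<in> CSYT n a b"
    let ?l = "rowlen T"
    have valid: "valid_shape a b ?l" using CSYT_valid[OF T] a_gt_1 by simp
    have "(\<Sum>i\<in>moves a b T. cyl_sum k (pos (rowlen (add_entry (Suc n) T i)))) =
        (\<Sum>i\<in>moves a b T. cyl_sum k (pos (?l(i := ?l i + 1))))"
      using rowlen_add_entry[OF T a_gt_1] by (intro sum.cong refl) simp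
    also have "\<dots> = (\<Sum>i<a. cyl_sum k (pos (?l(i := ?l i + 1))))"
      using cyl_sum_invalid[OF valid] by (intro sum.mono_neutral_left) (auto simp: moves_def)
    also have "\<dots> = cyl_sum (Suc k) (pos ?l)"
      unfolding cyl_sum_step pos_upd ..
    finally show "(\<Sum>i\<in>moves a b T. cyl_sum k (pos (rowlen (add_entry (Suc n) T i)))) =
        cyl_sum (Suc k) (pos ?l)" .
  qed
  finally show ?thesis .
qed

lemma card_CSYT: "of_nat (card (CSYT n a b)) = cyl_sum n int"
proof -
  have "(\<Sum>T\<in>CSYT n a b. cyl_sum k (pos (rowlen T))) = cyl_sum (n + k) int" for k
  proof (induction n arbitrary: k)
    case 0
    have "rowlen Map.empty = (\<lambda>_. 0)" by (auto simp: rowlen_def)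
    then have "pos (rowlen Map.empty) = int" by (auto simp: pos_def)
    then show ?case using CSYT_0[of a b] a_gt_1 by simp
  next
    case (Suc n)
    then show ?case by (simp add: sum_CSYT_step)
  qed
  from this[of 0] have "(\<Sum>T\<in>CSYT n a b. cyl_sum 0 (pos (rowlen T))) = cyl_sum n int" by simp
  moreover have "cyl_sum 0 (pos (rowlen T)) = 1" if "T \<in> CSYT n a b" for T
  proof (rule cyl_sum_init)
    have valid: "valid_shape a b (rowlen T)" using CSYT_valid[OF that] a_gt_1 by simp
    then have part: "is_partition (rowlen T)" by (simp add: valid_shape_def)
    show "pos (rowlen T) i < pos (rowlen T) j" if "i < j" "j < a" for i j
      using that partition_le[OF part, of i j] by (simp add: pos_def)
    show "pos (rowlen T) (a - 1) - pos (rowlen T) 0 < int N"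
    proof -
      have "int (a - 1) = int a - 1" using a_gt_1 by simp
      then show ?thesis using valid unfolding pos_def valid_shape_def N_def by simp
    qed
  qed
  ultimately show ?thesis by simp
qed

end

section \<open>Weighted walks of partitions in a box\<close>

definition box :: "nat \<Rightarrow> nat \<Rightarrow> (nat \<Rightarrow> nat) set" where
  "box h w = {l. is_partition l \<and> (\<forall>i\<ge>h. l i = 0) \<and> (\<forall>i. l i \<le> w)}"

definition adj :: "(nat \<Rightarrow> nat) \<Rightarrow> (nat \<Rightarrow> nat) \<Rightarrow> bool" where
  "adj x y \<longleftrightarrow> card (sym_diff (diagram x) (diagram y)) \<le> 1"

lemma finite_box: "finite (box h w)"
proof -
  have "box h w \<subseteq> {f. \<forall>i. (i \<in> {..<h} \<longrightarrow> f i \<in> {..w}) \<and> (i \<notin> {..<h} \<longrightarrow> f i = 0)}"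
    by (auto simp: box_def)
  moreover have "finite {f. \<forall>i. (i \<in> {..<h} \<longrightarrow> f i \<in> {..w}) \<and> (i \<notin> {..<h} \<longrightarrow> f i = (0::nat))}"
    by (rule finite_set_of_finite_funs) auto
  ultimately show ?thesis by (rule finite_subset)
qed

lemma diagram_row: "{j. (int i, j) \<in> diagram l} = {0..<int (l i)}"
  by (auto simp: mem_diagram)

lemma diagram_inj: "diagram x = diagram y \<Longrightarrow> x = y"
proof
  fix i assume "diagram x = diagram y"
  then have "{0..<int (x i)} = {0..<int (y i)}" unfolding diagram_row[symmetric] by simp
  then have "card {0..<int (x i)} = card {0..<int (y i)}" by (rule arg_cong)
  then show "x i = y i" by simp
qed

lemma finite_diagram:
  assumes "x \<in> box h w"
  shows "finite (diagram x)"
proof (rule finite_subset)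
  show "diagram x \<subseteq> {0..<int h} \<times> {0..<int w}"
  proof (rule subsetI, clarify)
    fix i j assume "(i, j) \<in> diagram x"
    then have "0 \<le> i" "0 \<le> j" "j < int (x (nat i))" by (auto simp: mem_diagram)
    moreover have "x (nat i) \<le> w" "int h \<le> i \<Longrightarrow> x (nat i) = 0"
      using assms by (auto simp: box_def)
    ultimately show "i \<in> {0..<int h} \<and> j \<in> {0..<int w}"
      by (cases "int h \<le> i") auto
  qed
qed auto

text \<open>
  Counting cells row by row shows that exactly one row grows, and by one cell.
\<close>

lemma diagram_singleton_diff:
  assumes "diagram y = insert c (diagram x)" "c \<notin> diagram x"
  shows "\<exists>i. y = x(i := x i + 1)"
proof -
  obtain r k where c: "c = (r, k)" by (cases c)
  have "(r, k) \<in> diagram y" using assms c by simp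
  then have "0 \<le> r" by (simp add: mem_diagram)
  define i where "i = nat r"
  have r: "r = int i" using \<open>0 \<le> r\<close> by (simp add: i_def)
  have "y j = (x(i := x i + 1)) j" for j
  proof -
    have row: "{0..<int (y j)} = (if j = i then insert k {0..<int (x j)} else {0..<int (x j)})"
      unfolding diagram_row[symmetric] assms(1) c r by auto
    have "k \<notin> {0..<int (x i)}" using assms(2) unfolding diagram_row[symmetric] c r by simp
    then have "card {0..<int (y j)} = (if j = i then x j + 1 else x j)"
      unfolding row by simp
    then show ?thesis by simp
  qed
  then have "y = x(i := x i + 1)" by (rule ext)
  then show ?thesis by blast
qed

lemma adj_commute: "adj x y \<longleftrightarrow> adj y x"
  unfolding adj_def by (simp only: Un_commute)

lemma adj_incr: "adj x (x(i := x i + 1))"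
proof -
  have "sym_diff (diagram x) (diagram (x(i := x i + 1))) = {(int i, int (x i))}"
    unfolding diagram_incr by (auto simp: mem_diagram)
  then show ?thesis unfolding adj_def by (simp only:) simp
qed

lemma incr_decr: "0 < x i \<Longrightarrow> (x(i := x i - 1))(i := (x(i := x i - 1)) i + 1) = (x :: nat \<Rightarrow> nat)"
  by (rule ext) simp

lemma incr_neq: "x(i := x i + 1) \<noteq> (x :: nat \<Rightarrow> nat)"
  by (simp add: fun_upd_idem_iff)

lemma decr_neq: "0 < x i \<Longrightarrow> x(i := x i - 1) \<noteq> (x :: nat \<Rightarrow> nat)"
  by (simp add: fun_upd_idem_iff)

lemma adj_iff:
  assumes x: "x \<in> box h w" and y: "y \<in> box h w"
  shows "adj x y \<longleftrightarrow> y = x \<or> (\<exists>i. y = x(i := x i + 1)) \<or> (\<exists>i. 0 < x i \<and> y = x(i := x i - 1))"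
    (is "_ \<longleftrightarrow> ?R")
proof
  assume "adj x y"
  let ?S = "sym_diff (diagram x) (diagram y)"
  have fin: "finite ?S" using finite_diagram[OF x] finite_diagram[OF y] by simp
  have "card ?S = 0 \<or> card ?S = 1" using \<open>adj x y\<close> unfolding adj_def by linarith
  then show ?R
  proof
    assume "card ?S = 0"
    then have "?S = {}" using fin by (simp only: card_0_eq)
    then have "diagram x = diagram y" by blast
    from diagram_inj[OF this] show ?R by simp
  next
    assume "card ?S = 1"
    then obtain c where c: "?S = {c}" by (rule card_1_singletonE)
    have diff: "(p \<in> diagram x \<and> p \<notin> diagram y) \<or> (p \<in> diagram y \<and> p \<notin> diagram x) \<longleftrightarrow> p = c" for p
      using eqset_imp_iff[OF c, of p] by simp
    show ?R
    proof (cases "c \<in> diagram x")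
      case False
      have "diagram y = insert c (diagram x)"
      proof (rule Set.set_eqI)
        fix p show "p \<in> diagram y \<longleftrightarrow> p \<in> insert c (diagram x)"
          using diff[of p] diff[of c] False by (cases "p = c") auto
      qed
      from diagram_singleton_diff[OF this False] show ?R by simp
    next
      case True
      have fresh: "c \<notin> diagram y" using diff[of c] True by simp
      have "diagram x = insert c (diagram y)"
      proof (rule Set.set_eqI)
        fix p show "p \<in> diagram x \<longleftrightarrow> p \<in> insert c (diagram y)"
          using diff[of p] True fresh by (cases "p = c") auto
      qed
      from diagram_singleton_diff[OF this fresh] obtain i where i: "x = y(i := y i + 1)" ..
      have "0 < x i" "y = x(i := x i - 1)" unfolding i by simp_all
      then show ?R by (intro disjI2 exI conjI)
    qed
  qed
next
  assume ?R
  then consider "y = x" | i where "y = x(i := x i + 1)" | i where "0 < x i" "y = x(i := x i - 1)"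
    by blast
  then show "adj x y"
  proof cases
    case 1
    then show ?thesis by (simp add: adj_def)
  next
    case 2
    then show ?thesis using adj_incr by simp
  next
    case (3 i)
    have "adj y x" using adj_incr[of y i] incr_decr[of x i] 3 by simp
    then show ?thesis by (simp only: adj_commute[of x y])
  qed
qed

definition ups :: "nat \<Rightarrow> nat \<Rightarrow> (nat \<Rightarrow> nat) \<Rightarrow> nat set" where
  "ups h w x = {i. i < h \<and> x(i := x i + 1) \<in> box h w}"

definition downs :: "nat \<Rightarrow> nat \<Rightarrow> (nat \<Rightarrow> nat) \<Rightarrow> nat set" where
  "downs h w x = {i. i < h \<and> 0 < x i \<and> x(i := x i - 1) \<in> box h w}"

lemma sum_neighbours:
  fixes f :: "(nat \<Rightarrow> nat) \<Rightarrow> 'a::comm_monoid_add"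
  assumes x: "x \<in> box h w"
  shows "(\<Sum>y | y \<in> box h w \<and> adj x y. f y) =
    f x + (\<Sum>i\<in>ups h w x. f (x(i := x i + 1))) + (\<Sum>i\<in>downs h w x. f (x(i := x i - 1)))"
proof -
  let ?U = "(\<lambda>i. x(i := x i + 1)) ` ups h w x" and ?D = "(\<lambda>i. x(i := x i - 1)) ` downs h w x"
  have fin: "finite (ups h w x)" "finite (downs h w x)"
    by (simp_all add: ups_def downs_def)
  have zero: "\<And>i. i \<ge> h \<Longrightarrow> x i = 0" using x by (simp add: box_def)
  have "{y. y \<in> box h w \<and> adj x y} = insert x (?U \<union> ?D)"
  proof (intro Set.set_eqI iffI)
    fix y assume "y \<in> {y. y \<in> box h w \<and> adj x y}"
    then have y: "y \<in> box h w" and "adj x y" by auto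
    then consider "y = x" | i where "y = x(i := x i + 1)" | i where "0 < x i" "y = x(i := x i - 1)"
      using adj_iff[OF x y] by blast
    then show "y \<in> insert x (?U \<union> ?D)"
    proof cases
      case 2
      have "i < h"
      proof (rule ccontr)
        assume "\<not> i < h"
        then have "y i = 0" using y by (simp add: box_def)
        then show False using 2 by simp
      qed
      then have "i \<in> ups h w x" using y 2 by (simp add: ups_def)
      then show ?thesis using 2 by blast
    next
      case 3
      have "i < h" using zero[of i] 3(1) by (cases "i < h") auto
      then have "i \<in> downs h w x" using y 3 by (simp add: downs_def)
      then show ?thesis using 3 by blast
    qed simp
  next
    fix y assume "y \<in> insert x (?U \<union> ?D)"
    then have "y \<in> box h w \<and> (y = x \<or> (\<exists>i. y = x(i := x i + 1)) \<or> (\<exists>i. 0 < x i \<and> y = x(i := x i - 1)))"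
      using x unfolding ups_def downs_def by blast
    then show "y \<in> {y. y \<in> box h w \<and> adj x y}" using adj_iff[OF x] by blast
  qed
  moreover have "inj_on (\<lambda>i. x(i := x i + 1)) (ups h w x)"
  proof (rule inj_onI, rule ccontr)
    fix i j assume eq: "x(i := x i + 1) = x(j := x j + 1)" and "i \<noteq> j"
    have "(x(i := x i + 1)) i = (x(j := x j + 1)) i" by (rule fun_cong[OF eq])
    then show False using \<open>i \<noteq> j\<close> by simp
  qed
  moreover have "inj_on (\<lambda>i. x(i := x i - 1)) (downs h w x)"
  proof (rule inj_onI, rule ccontr)
    fix i j assume i: "i \<in> downs h w x" and eq: "x(i := x i - 1) = x(j := x j - 1)" and "i \<noteq> j"
    have "(x(i := x i - 1)) i = (x(j := x j - 1)) i" by (rule fun_cong[OF eq])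
    then have "x i - 1 = x i" using \<open>i \<noteq> j\<close> by simp
    moreover have "0 < x i" using i by (simp add: downs_def)
    ultimately show False by linarith
  qed
  moreover have "x \<notin> ?U \<union> ?D"
  proof -
    have "x \<noteq> x(i := x i + 1)" for i using incr_neq[of x i] by (rule not_sym)
    moreover have "x \<noteq> x(i := x i - 1)" if "i \<in> downs h w x" for i
      by (rule not_sym[OF decr_neq]) (use that in \<open>simp add: downs_def\<close>)
    ultimately show ?thesis by blast
  qed
  moreover have "?U \<inter> ?D = {}"
  proof (rule ccontr)
    assume "?U \<inter> ?D \<noteq> {}"
    then obtain i j where eq: "x(i := x i + 1) = x(j := x j - 1)" and j: "0 < x j"
      unfolding downs_def by blast
    have "(x(i := x i + 1)) j = (x(j := x j - 1)) j" by (rule fun_cong[OF eq])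
    then show False using j by (simp split: if_splits)
  qed
  ultimately show ?thesis
    using fin by (simp add: sum.union_disjoint sum.reindex add.assoc)
qed

text \<open>
  Generalizing the starting point makes the walks accessible to induction on the first step.
\<close>

definition paths :: "nat \<Rightarrow> nat \<Rightarrow> nat \<Rightarrow> (nat \<Rightarrow> nat) \<Rightarrow> (nat \<Rightarrow> nat) list set" where
  "paths h w n x = {p. length p = Suc n \<and> p ! 0 = x \<and> p ! n = (\<lambda>_. 0) \<and> set p \<subseteq> box h w \<and>
     (\<forall>i<n. adj (p ! i) (p ! Suc i))}"

lemma VT_paths: "VT n h w = paths h w n (\<lambda>_. 0)"
  unfolding VT_def paths_def box_def adj_def by auto

lemma zero_in_box: "(\<lambda>_. 0) \<in> box h w"
  by (simp add: box_def is_partition_def antimono_def)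

lemma paths_0: "paths h w 0 x = (if x = (\<lambda>_. 0) then {[x]} else {})"
  by (auto simp: paths_def length_Suc_conv zero_in_box)

lemma paths_Suc:
  assumes "x \<in> box h w"
  shows "paths h w (Suc n) x = (\<Union>y\<in>{y. y \<in> box h w \<and> adj x y}. (#) x ` paths h w n y)"
proof (intro Set.set_eqI iffI)
  fix p assume p: "p \<in> paths h w (Suc n) x"
  then obtain q where q: "p = x # q" "length q = Suc n"
    by (auto simp: paths_def length_Suc_conv)
  have "q \<in> paths h w n (q ! 0)"
    unfolding paths_def
  proof (intro CollectI conjI allI impI)
    fix i assume "i < n"
    then have "adj (p ! Suc i) (p ! Suc (Suc i))" using p unfolding paths_def by blast
    then show "adj (q ! i) (q ! Suc i)" by (simp add: q)
  qed (use p q in \<open>auto simp: paths_def\<close>)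
  moreover have "adj (p ! 0) (p ! Suc 0)" using p unfolding paths_def by blast
  then have "adj x (q ! 0)" by (simp add: q)
  moreover have "q ! 0 \<in> set q" using q by simp
  then have "q ! 0 \<in> box h w" using p q by (auto simp: paths_def)
  ultimately show "p \<in> (\<Union>y\<in>{y. y \<in> box h w \<and> adj x y}. (#) x ` paths h w n y)"
    using q(1) by blast
next
  fix p assume "p \<in> (\<Union>y\<in>{y. y \<in> box h w \<and> adj x y}. (#) x ` paths h w n y)"
  then obtain y q where y: "adj x y" "y \<in> box h w" and q: "q \<in> paths h w n y" "p = x # q" by blast
  have "adj (p ! i) (p ! Suc i)" if "i < Suc n" for i
    using that y q by (cases i) (auto simp: paths_def)
  then show "p \<in> paths h w (Suc n) x"
    using q assms by (auto simp: paths_def)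
qed

lemma finite_paths: "x \<in> box h w \<Longrightarrow> finite (paths h w n x)"
proof (induction n arbitrary: x)
  case 0
  then show ?case by (simp add: paths_0)
next
  case (Suc n)
  have "finite {y. y \<in> box h w \<and> adj x y}" using finite_box[of h w] by simp
  then show ?case using Suc by (simp add: paths_Suc)
qed

definition path_weight :: "((nat \<Rightarrow> nat) \<Rightarrow> int) \<Rightarrow> (nat \<Rightarrow> nat) list \<Rightarrow> int" where
  "path_weight \<zeta> p = (\<Prod>i\<in>zero_steps p. \<zeta> (p ! i))"

lemma zero_steps_Cons:
  assumes "q \<noteq> []"
  shows "zero_steps (x # q) = (if x = q ! 0 then {0} else {}) \<union> Suc ` zero_steps q"
proof (rule Set.set_eqI)
  fix i show "i \<in> zero_steps (x # q) \<longleftrightarrow>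
      i \<in> (if x = q ! 0 then {0} else {}) \<union> Suc ` zero_steps q"
    using assms by (cases i) (auto simp: zero_steps_def)
qed

lemma finite_zero_steps: "finite (zero_steps p)"
  by (rule finite_subset[of _ "{..<length p}"]) (auto simp: zero_steps_def)

lemma path_weight_Cons:
  assumes "q \<noteq> []"
  shows "path_weight \<zeta> (x # q) = (if x = q ! 0 then \<zeta> x else 1) * path_weight \<zeta> q"
proof -
  have "(\<Prod>i\<in>Suc ` zero_steps q. \<zeta> ((x # q) ! i)) = path_weight \<zeta> q"
    unfolding path_weight_def by (subst prod.reindex) auto
  then show ?thesis
    using finite_zero_steps[of q] unfolding path_weight_def[of \<zeta> "x # q"] zero_steps_Cons[OF assms]
    by (subst prod.union_disjoint) auto
qed

lemma sum_paths_Suc: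
  assumes x: "x \<in> box h w"
  shows "(\<Sum>p\<in>paths h w (Suc n) x. path_weight \<zeta> p) =
    \<zeta> x * (\<Sum>p\<in>paths h w n x. path_weight \<zeta> p) +
    (\<Sum>i\<in>ups h w x. \<Sum>p\<in>paths h w n (x(i := x i + 1)). path_weight \<zeta> p) +
    (\<Sum>i\<in>downs h w x. \<Sum>p\<in>paths h w n (x(i := x i - 1)). path_weight \<zeta> p)"
proof -
  let ?W = "\<lambda>y. \<Sum>p\<in>paths h w n y. path_weight \<zeta> p"
  have start: "q \<in> paths h w n y \<Longrightarrow> q \<noteq> [] \<and> q ! 0 = y" for q y
    by (auto simp: paths_def)
  have "(\<Sum>p\<in>paths h w (Suc n) x. path_weight \<zeta> p) =
      (\<Sum>y | y \<in> box h w \<and> adj x y. \<Sum>p\<in>(#) x ` paths h w n y. path_weight \<zeta> p)"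
    unfolding paths_Suc[OF x]
  proof (rule sum.UNION_disjoint)
    show "finite {y. y \<in> box h w \<and> adj x y}" using finite_box[of h w] by simp
    show "\<forall>y\<in>{y. y \<in> box h w \<and> adj x y}. finite ((#) x ` paths h w n y)"
      using finite_paths by blast
    show "\<forall>y\<in>{y. y \<in> box h w \<and> adj x y}. \<forall>y'\<in>{y. y \<in> box h w \<and> adj x y}.
        y \<noteq> y' \<longrightarrow> (#) x ` paths h w n y \<inter> (#) x ` paths h w n y' = {}"
    proof (intro ballI impI equals0I)
      fix y y' p
      assume "y \<noteq> y'" and "p \<in> (#) x ` paths h w n y \<inter> (#) x ` paths h w n y'"
      then obtain q where "q \<in> paths h w n y" "q \<in> paths h w n y'" by blast
      then show False using start \<open>y \<noteq> y'\<close> by blast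
    qed
  qed
  also have "\<dots> = (\<Sum>y | y \<in> box h w \<and> adj x y. (if x = y then \<zeta> x else 1) * ?W y)"
  proof (rule sum.cong[OF refl])
    fix y
    have "(\<Sum>p\<in>(#) x ` paths h w n y. path_weight \<zeta> p) = (\<Sum>q\<in>paths h w n y. path_weight \<zeta> (x # q))"
      by (subst sum.reindex) auto
    also have "\<dots> = (\<Sum>q\<in>paths h w n y. (if x = y then \<zeta> x else 1) * path_weight \<zeta> q)"
      using start by (intro sum.cong refl) (simp add: path_weight_Cons)
    finally show "(\<Sum>p\<in>(#) x ` paths h w n y. path_weight \<zeta> p) = (if x = y then \<zeta> x else 1) * ?W y"
      by (simp add: sum_distrib_left)
  qed
  also have "\<dots> = \<zeta> x * ?W x + (\<Sum>i\<in>ups h w x. ?W (x(i := x i + 1))) +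
      (\<Sum>i\<in>downs h w x. ?W (x(i := x i - 1)))"
  proof -
    have "x \<noteq> x(i := x i + 1)" for i using incr_neq[of x i] by (rule not_sym)
    moreover have "x \<noteq> x(i := x i - 1)" if "i \<in> downs h w x" for i
      by (rule not_sym[OF decr_neq]) (use that in \<open>simp add: downs_def\<close>)
    ultimately show ?thesis
      unfolding sum_neighbours[OF x] by (intro arg_cong2[where f = "(+)"] sum.cong refl) simp_all
  qed
  finally show ?thesis .
qed

section \<open>Comparison of the two counts\<close>

lemma box_incr_iff:
  assumes x: "x \<in> box h w" and k: "k < h"
  shows "x(k := x k + 1) \<in> box h w \<longleftrightarrow> (if k = 0 then x 0 < w else x k < x (k - 1))"
proof -
  have part: "is_partition x" and zero: "\<And>i. h \<le> i \<Longrightarrow> x i = 0" and le: "\<And>i. x i \<le> w"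
    using x by (auto simp: box_def)
  show ?thesis
  proof
    assume in_box: "x(k := x k + 1) \<in> box h w"
    then have part': "is_partition (x(k := x k + 1))" and "(x(k := x k + 1)) k \<le> w"
      unfolding box_def by blast+
    then show "if k = 0 then x 0 < w else x k < x (k - 1)"
      using partition_le[OF part', of "k - 1" k] by (cases k) auto
  next
    assume ok: "if k = 0 then x 0 < w else x k < x (k - 1)"
    then have "is_partition (x(k := x k + 1))"
      by (intro is_partition_upd_incr[OF part]) (auto split: if_splits)
    moreover have "x k < w" using ok le[of "k - 1"] by (auto split: if_splits)
    ultimately show "x(k := x k + 1) \<in> box h w"
      using zero le k by (auto simp: box_def)
  qed
qed

lemma box_decr_iff:
  assumes x: "x \<in> box h w" and k: "k < h"
  shows "0 < x k \<and> x(k := x k - 1) \<in> box h w \<longleftrightarrow> x (Suc k) < x k"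
proof -
  have part: "is_partition x" and zero: "\<And>i. h \<le> i \<Longrightarrow> x i = 0" and le: "\<And>i. x i \<le> w"
    using x by (auto simp: box_def)
  show ?thesis
  proof
    assume *: "0 < x k \<and> x(k := x k - 1) \<in> box h w"
    then have "is_partition (x(k := x k - 1))" by (simp add: box_def)
    from partition_le[OF this, of k "Suc k"] have "x (Suc k) \<le> x k - 1" by simp
    then show "x (Suc k) < x k" using * by linarith
  next
    assume less: "x (Suc k) < x k"
    have "is_partition (x(k := x k - 1))" by (rule is_partition_upd_decr[OF part less])
    moreover have "x k - 1 \<le> w" using le[of k] by linarith
    ultimately have "x(k := x k - 1) \<in> box h w"
      using zero le k by (auto simp: box_def)
    then show "0 < x k \<and> x(k := x k - 1) \<in> box h w" using less by simp
  qed
qed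

context cylinder
begin

text \<open>
  The \<open>i\<close>-th particle from below belongs to the \<open>i\<close>-th row counted from the last one, so that the
  positions increase with \<open>i\<close> and the empty partition is the packed configuration.
\<close>

definition site :: "(nat \<Rightarrow> nat) \<Rightarrow> nat \<Rightarrow> int" where
  "site x i = int (x (h - Suc i)) + int i + 1"

text \<open>
  The weight of a zero step.  The three terms stem from the unpaired eigenvalue \<open>1\<close> of the circle and
  from the boundary conditions at the two ends of the line.
\<close>

definition zeta :: "(nat \<Rightarrow> nat) \<Rightarrow> int" where
  "zeta x = int c + (if x (h - 1) = 0 then int e else 0) - (if x 0 = w then int gm else 0)"

lemma box_sum_site_upd:
  assumes "k < h"
  shows "box_sum n (site (x(k := v))) = box_sum n ((site x)(h - Suc k := int v + int (h - Suc k) + 1))"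
proof (rule box_sum_cong)
  fix i assume "i < h"
  then have "h - Suc i = k \<longleftrightarrow> i = h - Suc k" using assms by linarith
  then show "site (x(k := v)) i = ((site x)(h - Suc k := int v + int (h - Suc k) + 1)) i"
    by (auto simp: site_def)
qed

lemma site_at: "k < h \<Longrightarrow> site x (h - Suc k) = int (x k) + int (h - Suc k) + 1"
  by (simp add: site_def Suc_diff_Suc)

text \<open>
  A step of row \<open>k\<close> out of the box is either a collision with the particle above, where \<open>box_sum\<close>
  vanishes, or a step of the first row beyond \<open>w\<close>, which is reflected into a weighted zero step.
\<close>

lemma box_sum_up:
  assumes x: "x \<in> box h w" and k: "k < h"
  shows "box_sum n ((site x)(h - Suc k := site x (h - Suc k) + 1)) =
    (if x(k := x k + 1) \<in> box h w then box_sum n (site (x(k := x k + 1))) else 0) -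
    (if k = 0 \<and> x 0 = w then of_nat gm * box_sum n (site x) else 0)"
proof (cases "x(k := x k + 1) \<in> box h w")
  case True
  then have "\<not> (k = 0 \<and> x 0 = w)" using box_incr_iff[OF x k] by (auto split: if_splits)
  moreover have "box_sum n ((site x)(h - Suc k := site x (h - Suc k) + 1)) = box_sum n (site (x(k := x k + 1)))"
    unfolding box_sum_site_upd[OF k] site_at[OF k] by (simp add: algebra_simps)
  ultimately show ?thesis using True by (simp only: if_True if_False diff_zero)
next
  case False
  show ?thesis
  proof (cases "k = 0")
    case True
    have "x 0 \<le> w" using x by (simp add: box_def)
    then have top: "x 0 = w" using False box_incr_iff[OF x k] True by simp
    have M: "site x (h - Suc k) = int M"
      using site_at[OF k, of x] h_pos by (simp add: True top M_def)
    have "box_sum n ((site x)(h - Suc k := int M + 1)) = - of_nat gm * box_sum n ((site x)(h - Suc k := int M))"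
      by (rule box_sum_top) (use h_pos in simp)
    also have "(site x)(h - Suc k := int M) = site x"
      unfolding M[symmetric] by (rule fun_upd_triv)
    finally have "box_sum n ((site x)(h - Suc k := int M + 1)) = - of_nat gm * box_sum n (site x)" .
    then show ?thesis unfolding M if_not_P[OF False] if_P[OF conjI[OF True top]] by simp
  next
    case pos: False
    then obtain m where m: "k = Suc m" by (cases k) auto
    have "x k \<le> x m" using x m partition_le[of x m k] by (simp add: box_def)
    then have eq: "x k = x m" using False box_incr_iff[OF x k] m by simp
    have "m < h" "h - Suc m = Suc (h - Suc k)" using k m by auto
    then have "site x (h - Suc m) = site x (h - Suc k) + 1"
      using k unfolding site_at[OF k] site_at[OF \<open>m < h\<close>] eq by simp
    then have "box_sum n ((site x)(h - Suc k := site x (h - Suc k) + 1)) = 0"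
      using k \<open>h - Suc m = Suc (h - Suc k)\<close>
      by (intro box_sum_equal[of "h - Suc k" "h - Suc m"]) auto
    then show ?thesis using False pos by simp
  qed
qed

text \<open>
  A downward step out of the box is a collision with the particle below, or a step of the last row
  below \<open>0\<close>, which is reflected into a weighted zero step.
\<close>

lemma box_sum_down:
  assumes x: "x \<in> box h w" and k: "k < h"
  shows "box_sum n ((site x)(h - Suc k := site x (h - Suc k) - 1)) =
    (if 0 < x k \<and> x(k := x k - 1) \<in> box h w then box_sum n (site (x(k := x k - 1))) else 0) +
    (if k = h - 1 \<and> x (h - 1) = 0 then of_nat e * box_sum n (site x) else 0)"
proof (cases "x (Suc k) < x k")
  case True
  then have "0 < x k \<and> x(k := x k - 1) \<in> box h w" using box_decr_iff[OF x k] by blast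
  moreover have "box_sum n ((site x)(h - Suc k := site x (h - Suc k) - 1)) = box_sum n (site (x(k := x k - 1)))"
  proof -
    have "int (x k - 1) = int (x k) - 1" using True by simp
    then show ?thesis
      unfolding box_sum_site_upd[OF k] site_at[OF k] by (simp add: algebra_simps)
  qed
  moreover have "\<not> (k = h - 1 \<and> x (h - 1) = 0)" using True by auto
  ultimately show ?thesis by (simp only: if_True if_False add_0_right simp_thms)
next
  case False
  have no: "\<not> (0 < x k \<and> x(k := x k - 1) \<in> box h w)" using box_decr_iff[OF x k] False by blast
  have "x (Suc k) \<le> x k" using x partition_le[of x k "Suc k"] by (simp add: box_def)
  then have eq: "x (Suc k) = x k" using False by simp
  show ?thesis
  proof (cases "Suc k < h")
    case True
    then have i: "h - Suc k = Suc (h - Suc (Suc k))" by simp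
    then have "site x (h - Suc (Suc k)) = site x (h - Suc k) - 1"
      unfolding site_at[OF k] site_at[OF True] eq by simp
    then have "box_sum n ((site x)(h - Suc k := site x (h - Suc k) - 1)) = 0"
      using k i by (intro box_sum_equal[of "h - Suc k" "h - Suc (Suc k)"]) auto
    then show ?thesis using no True by auto
  next
    case last: False
    then have kh: "k = h - 1" "h - Suc k = 0" using k by auto
    have "x (Suc k) = 0" using x last by (simp add: box_def)
    then have zero: "x k = 0" using eq by simp
    have one: "site x 0 = 1" using zero kh by (simp add: site_def)
    have "box_sum n ((site x)(0 := 0)) = of_nat e * box_sum n ((site x)(0 := 1))"
      by (rule box_sum_bottom[OF h_pos])
    also have "(site x)(0 := 1) = site x"
      unfolding one[symmetric] by (rule fun_upd_triv)
    finally have bottom: "box_sum n ((site x)(0 := 0)) = of_nat e * box_sum n (site x)" .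
    have "x (h - 1) = 0" using zero kh(1) by simp
    show ?thesis
      unfolding kh(2) one if_not_P[OF no] if_P[OF conjI[OF kh(1) \<open>x (h - 1) = 0\<close>]] using bottom by simp
  qed
qed

lemma box_sum_site_step:
  assumes x: "x \<in> box h w"
  shows "box_sum (Suc n) (site x) = of_int (zeta x) * box_sum n (site x) +
    (\<Sum>i\<in>ups h w x. box_sum n (site (x(i := x i + 1)))) + (\<Sum>i\<in>downs h w x. box_sum n (site (x(i := x i - 1))))"
proof -
  let ?up = "\<lambda>i. box_sum n ((site x)(i := site x i + 1))" and ?down = "\<lambda>i. box_sum n ((site x)(i := site x i - 1))"
  have "(\<Sum>i<h. ?up i) = (\<Sum>k<h. ?up (h - Suc k))" by (rule sum.nat_diff_reindex[symmetric])
  also have "\<dots> = (\<Sum>k<h. (if x(k := x k + 1) \<in> box h w then box_sum n (site (x(k := x k + 1))) else 0)) -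
      (\<Sum>k<h. if k = 0 \<and> x 0 = w then of_nat gm * box_sum n (site x) else 0)"
    unfolding sum_subtractf[symmetric] using box_sum_up[OF x] by (intro sum.cong refl) simp
  also have "(\<Sum>k<h. if k = 0 \<and> x 0 = w then of_nat gm * box_sum n (site x) else 0) =
      (if x 0 = w then of_nat gm else 0) * box_sum n (site x)"
  proof -
    have "(\<Sum>k<h. if k = 0 \<and> x 0 = w then of_nat gm * box_sum n (site x) else 0) =
        (\<Sum>k<h. if k = 0 then (if x 0 = w then of_nat gm else 0) * box_sum n (site x) else 0)"
      by (intro sum.cong refl) simp
    then show ?thesis using h_pos by (simp add: sum.delta)
  qed
  also have "(\<Sum>k<h. (if x(k := x k + 1) \<in> box h w then box_sum n (site (x(k := x k + 1))) else 0)) =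
      (\<Sum>i\<in>ups h w x. box_sum n (site (x(i := x i + 1))))"
    unfolding ups_def by (simp add: sum.inter_filter[symmetric] lessThan_def)
  finally have up: "(\<Sum>i<h. ?up i) = (\<Sum>i\<in>ups h w x. box_sum n (site (x(i := x i + 1)))) -
      (if x 0 = w then of_nat gm else 0) * box_sum n (site x)" .
  have "(\<Sum>i<h. ?down i) = (\<Sum>k<h. ?down (h - Suc k))" by (rule sum.nat_diff_reindex[symmetric])
  also have "\<dots> = (\<Sum>k<h. (if 0 < x k \<and> x(k := x k - 1) \<in> box h w then box_sum n (site (x(k := x k - 1))) else 0)) +
      (\<Sum>k<h. if k = h - 1 \<and> x (h - 1) = 0 then of_nat e * box_sum n (site x) else 0)"
    unfolding sum.distrib[symmetric] using box_sum_down[OF x] by (intro sum.cong refl) simp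
  also have "(\<Sum>k<h. if k = h - 1 \<and> x (h - 1) = 0 then of_nat e * box_sum n (site x) else 0) =
      (if x (h - 1) = 0 then of_nat e else 0) * box_sum n (site x)"
  proof -
    have "(\<Sum>k<h. if k = h - 1 \<and> x (h - 1) = 0 then of_nat e * box_sum n (site x) else 0) =
        (\<Sum>k<h. if k = h - 1 then (if x (h - 1) = 0 then of_nat e else 0) * box_sum n (site x) else 0)"
      by (intro sum.cong refl) simp
    then show ?thesis using h_pos by (simp add: sum.delta)
  qed
  also have "(\<Sum>k<h. (if 0 < x k \<and> x(k := x k - 1) \<in> box h w then box_sum n (site (x(k := x k - 1))) else 0)) =
      (\<Sum>i\<in>downs h w x. box_sum n (site (x(i := x i - 1))))"
    unfolding downs_def by (simp add: sum.inter_filter[symmetric] lessThan_def)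
  finally have down: "(\<Sum>i<h. ?down i) = (\<Sum>i\<in>downs h w x. box_sum n (site (x(i := x i - 1)))) +
      (if x (h - 1) = 0 then of_nat e else 0) * box_sum n (site x)" .
  have zeta: "of_int (zeta x) = of_nat c + (if x (h - 1) = 0 then of_nat e else 0) -
      (if x 0 = w then of_nat gm else (0 :: complex))"
    by (simp add: zeta_def)
  show ?thesis
    unfolding box_sum_step sum.distrib up down zeta by (simp add: algebra_simps)
qed

lemma box_sum_site_init:
  assumes x: "x \<in> box h w"
  shows "box_sum 0 (site x) = (if x = (\<lambda>_. 0) then 1 else 0)"
proof -
  have part: "is_partition x" using x by (simp add: box_def)
  have "box_sum 0 (site x) = (if \<forall>i<h. site x i = int i + 1 then 1 else 0)"
  proof (rule box_sum_init)
    show "site x i < site x j" if "i < j" "j < h" for i j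
    proof -
      have "x (h - Suc i) \<le> x (h - Suc j)" using that by (intro partition_le[OF part]) simp
      then show ?thesis using that by (simp add: site_def)
    qed
    show "1 \<le> site x i \<and> site x i \<le> int M" if "i < h" for i
    proof -
      have "x (h - Suc i) \<le> w" using x by (simp add: box_def)
      then show ?thesis using that by (simp add: site_def M_def)
    qed
  qed
  moreover have "(\<forall>i<h. site x i = int i + 1) \<longleftrightarrow> x = (\<lambda>_. 0)"
  proof
    assume packed: "\<forall>i<h. site x i = int i + 1"
    show "x = (\<lambda>_. 0)"
    proof
      fix k show "x k = 0"
      proof (cases "k < h")
        case True
        have "h - Suc k < h" using True by simp
        then have "site x (h - Suc k) = int (h - Suc k) + 1" using packed by blast
        then show ?thesis unfolding site_at[OF True] by simp
      next
        case False
        then show ?thesis using x by (simp add: box_def)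
      qed
    qed
  qed (simp add: site_def)
  ultimately show ?thesis by simp
qed

lemma sum_paths_eq_box_sum:
  "x \<in> box h w \<Longrightarrow> of_int (\<Sum>p\<in>paths h w n x. path_weight zeta p) = box_sum n (site x)"
proof (induction n arbitrary: x)
  case 0
  have "path_weight zeta [y] = 1" for y by (simp add: path_weight_def zero_steps_def)
  then show ?case using box_sum_site_init[OF 0] by (simp add: paths_0)
next
  case (Suc n)
  have "of_int (\<Sum>p\<in>paths h w n (x(i := x i + 1)). path_weight zeta p) = box_sum n (site (x(i := x i + 1)))"
    if "i \<in> ups h w x" for i
    using that Suc.IH[of "x(i := x i + 1)"] unfolding ups_def by blast
  moreover have "of_int (\<Sum>p\<in>paths h w n (x(i := x i - 1)). path_weight zeta p) = box_sum n (site (x(i := x i - 1)))"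
    if "i \<in> downs h w x" for i
    using that Suc.IH[of "x(i := x i - 1)"] unfolding downs_def by blast
  ultimately show ?case
    unfolding sum_paths_Suc[OF Suc.prems] box_sum_site_step[OF Suc.prems] Suc.IH[OF Suc.prems, symmetric]
    by (simp only: of_int_add of_int_mult of_int_sum[of _ "ups h w x"] of_int_sum[of _ "downs h w x"]
        cong: sum.cong)
qed

theorem card_CSYT_eq_weighted_VT:
  "int (card (CSYT n a b)) = (\<Sum>p\<in>VT n h w. path_weight zeta p)"
proof -
  have "of_int (\<Sum>p\<in>VT n h w. path_weight zeta p) = box_sum n (site (\<lambda>_. 0))"
    unfolding VT_paths by (rule sum_paths_eq_box_sum[OF zero_in_box])
  also have "site (\<lambda>_. 0) = (\<lambda>i. int i + 1)" by (simp add: site_def fun_eq_iff)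
  also have "box_sum n (\<lambda>i. int i + 1) = of_nat (card (CSYT n a b))"
    by (simp add: card_CSYT cyl_sum_packed)
  finally have "of_int (\<Sum>p\<in>VT n h w. path_weight zeta p) = (of_int (int (card (CSYT n a b))) :: complex)"
    by simp
  then show ?thesis by (simp only: of_int_eq_iff)
qed

end

lemma finite_VT: "finite (VT n h w)"
  unfolding VT_paths by (rule finite_paths[OF zero_in_box])

lemma sum_indicator_weight:
  assumes "\<And>x. \<zeta> x = (if Q x then 1 else 0)"
  shows "(\<Sum>p\<in>VT n h w. path_weight \<zeta> p) = int (card {p \<in> VT n h w. \<forall>i\<in>zero_steps p. Q (p ! i)})"
proof -
  have "path_weight \<zeta> p = (if \<forall>i\<in>zero_steps p. Q (p ! i) then 1 else 0)" for p
  proof (cases "\<forall>i\<in>zero_steps p. Q (p ! i)")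
    case True
    then show ?thesis unfolding path_weight_def assms by simp
  next
    case False
    then show ?thesis unfolding path_weight_def assms
      by (auto intro!: prod_zero simp: finite_zero_steps)
  qed
  then show ?thesis
    using finite_VT[of n h w] by (simp add: sum.inter_filter[symmetric])
qed

text \<open>
  Zero steps on neither or on both hyperplanes have weight \<open>0\<close>, and the others have weight \<open>1\<close> or
  \<open>-1\<close>.
\<close>

lemma sum_signed_weight:
  assumes "\<And>x. \<zeta> x = (if x (h - 1) = 0 then 1 else 0) - (if x 0 = w then 1 else 0)"
  shows "(\<Sum>p\<in>VT n h w. path_weight \<zeta> p) = (\<Sum>p\<in>VT_prime n h w. (- 1) ^ num_zero_w w p)"
proof -
  let ?Q = "\<lambda>p. \<forall>i\<in>zero_steps p. ((p ! i) (h - 1) = 0) \<noteq> ((p ! i) 0 = w)"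
  have "path_weight \<zeta> p = (if ?Q p then (- 1) ^ num_zero_w w p else 0)" for p
  proof (cases "?Q p")
    case True
    then have "path_weight \<zeta> p = (\<Prod>i\<in>zero_steps p. if (p ! i) 0 = w then - 1 else 1)"
      unfolding path_weight_def assms by (intro prod.cong refl) auto
    also have "\<dots> = (\<Prod>i\<in>{i \<in> zero_steps p. (p ! i) 0 = w}. - 1)"
      by (rule prod.inter_filter[symmetric, OF finite_zero_steps])
    also have "\<dots> = (- 1) ^ num_zero_w w p" by (simp add: num_zero_w_def)
    finally show ?thesis unfolding if_P[OF True] .
  next
    case False
    then have "\<exists>i\<in>zero_steps p. \<not> (((p ! i) (h - 1) = 0) \<noteq> ((p ! i) 0 = w))"
      by (rule ball_simps(10)[THEN iffD1])
    then obtain i where i: "i \<in> zero_steps p"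
      and "\<not> (((p ! i) (h - 1) = 0) \<noteq> ((p ! i) 0 = w))" by (rule bexE)
    then have eq: "((p ! i) (h - 1) = 0) = ((p ! i) 0 = w)" by (simp only: not_not)
    have "\<zeta> (p ! i) = 0" unfolding assms[of "p ! i"] eq by (rule diff_self)
    then have "\<exists>i\<in>zero_steps p. \<zeta> (p ! i) = 0" using i by (rule bexI)
    then have "path_weight \<zeta> p = 0"
      unfolding path_weight_def by (rule prod_zero[OF finite_zero_steps])
    then show ?thesis unfolding if_not_P[OF False] .
  qed
  then show ?thesis
    unfolding VT_prime_def by (simp only: sum.inter_filter[OF finite_VT])
qed

theorem corollary8p2:
  fixes h w n :: nat
  assumes "h > 0" and "w > 0" and "n > 0"
  shows "card (CSYT n (2 * h + 1) (2 * w + 1)) = card (VT n h w)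
    \<and> card (CSYT n (2 * h + 1) (2 * w)) = card (VT_wstar n h w)
    \<and> card (CSYT n (2 * h) (2 * w + 1)) = card (VT_hstar n h w)
    \<and> int (card (CSYT n (2 * h) (2 * w))) = (\<Sum>p\<in>VT_prime n h w. (- 1) ^ num_zero_w w p)"
proof -
  let ?zeta = "\<lambda>c gm x. int c + (if x (h - 1) = 0 then int (1 - c) else 0) -
      (if x 0 = w then int gm else 0)"
  have main: "int (card (CSYT n (2 * h + c) (2 * w + 1 - gm))) =
      (\<Sum>p\<in>VT n h w. path_weight (?zeta c gm) p)" if "c \<le> 1" "gm \<le> 1" for c gm
  proof -
    interpret cylinder h w c gm by unfold_locales (use assms that in auto)
    have "zeta = ?zeta c gm" by (rule ext) (simp add: zeta_def e_def)
    then show ?thesis using card_CSYT_eq_weighted_VT[of n] unfolding a_def b_def by simp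
  qed
  have "int (card (CSYT n (2 * h + 1) (2 * w + 1))) = (\<Sum>p\<in>VT n h w. path_weight (?zeta 1 0) p)"
    using main[of 1 0] by simp
  also have "\<dots> = int (card {p \<in> VT n h w. \<forall>i\<in>zero_steps p. True})"
    by (rule sum_indicator_weight) simp
  finally have "card (CSYT n (2 * h + 1) (2 * w + 1)) = card (VT n h w)" by simp
  moreover have "int (card (CSYT n (2 * h + 1) (2 * w))) = (\<Sum>p\<in>VT n h w. path_weight (?zeta 1 1) p)"
    using main[of 1 1] by simp
  then have "int (card (CSYT n (2 * h + 1) (2 * w))) =
      int (card {p \<in> VT n h w. \<forall>i\<in>zero_steps p. (p ! i) 0 \<noteq> w})"
    by (rule trans[OF _ sum_indicator_weight]) simp
  moreover have "int (card (CSYT n (2 * h) (2 * w + 1))) = (\<Sum>p\<in>VT n h w. path_weight (?zeta 0 0) p)"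
    using main[of 0 0] by simp
  then have "int (card (CSYT n (2 * h) (2 * w + 1))) =
      int (card {p \<in> VT n h w. \<forall>i\<in>zero_steps p. (p ! i) (h - 1) = 0})"
    by (rule trans[OF _ sum_indicator_weight]) simp
  moreover have "int (card (CSYT n (2 * h) (2 * w))) = (\<Sum>p\<in>VT n h w. path_weight (?zeta 0 1) p)"
    using main[of 0 1] by simp
  then have "int (card (CSYT n (2 * h) (2 * w))) =
      (\<Sum>p\<in>VT_prime n h w. (- 1) ^ num_zero_w w p)"
    by (rule trans[OF _ sum_signed_weight]) simp
  ultimately show ?thesis
    unfolding VT_wstar_def VT_hstar_def by simp
qed

end
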